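(* Let $r\ge 2$ be an integer, let $s$ be the unique positive real number satisfying $r/2+s=(s+1)\log(s+1)$, and let $\alpha_r=(s+1)^{\frac{1}{r/2+s}}=e^{\frac{1}{s+1}}$. Then for every tree $T$ with $n$ vertices, $$s_r(K_2,T)\le (s+1)\left(e^{\frac1r}\alpha_r\right)^{n-1}.$$
   Context: $\log$ denotes the natural logarithm. All graphs are finite and simple. The distance between two edges $e,e'$ of a graph $G$ is the minimum of $\mathrm{dist}_G(v,v')$ over vertices $v$ incident to $e$ and $v'$ incident to $e'$ (so two edges sharing a vertex have distance $0$). For an integer $r\ge1$, an $r$-matching in $G$ is a set of edges of $G$ such that any two distinct edges in the set have distance at least $r$; the empty set is an $r$-matching. $s_r(K_2,G)$ denotes the number of $r$-matchings in $G$. *)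

theory Defs
  imports Complex_Main "HOL-Library.Extended_Nat"
begin

text \<open>
  A graph is given by its vertex set \<open>V\<close> and its set \<open>E\<close> of edges, an edge being the
  two-element set of its endpoints.
\<close>

definition fin_simple_graph :: "'a set \<Rightarrow> 'a set set \<Rightarrow> bool" where
  "fin_simple_graph V E \<longleftrightarrow> finite V \<and> (\<forall>e\<in>E. e \<subseteq> V \<and> card e = 2)"

text \<open>A walk is the nonempty list of the vertices it visits; it has \<open>length p - 1\<close> steps.\<close>

definition is_walk :: "'a set \<Rightarrow> 'a set set \<Rightarrow> 'a list \<Rightarrow> bool" where
  "is_walk V E p \<longleftrightarrow> p \<noteq> [] \<and> set p \<subseteq> V \<and> (\<forall>i. Suc i < length p \<longrightarrow> {p ! i, p ! Suc i} \<in> E)"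

definition walk_between :: "'a set \<Rightarrow> 'a set set \<Rightarrow> 'a \<Rightarrow> 'a list \<Rightarrow> 'a \<Rightarrow> bool" where
  "walk_between V E u p v \<longleftrightarrow> is_walk V E p \<and> hd p = u \<and> last p = v"

text \<open>The distance is \<open>\<infinity>\<close> (the infimum of the empty set) if there is no walk from \<open>u\<close> to \<open>v\<close>.\<close>

definition graph_dist :: "'a set \<Rightarrow> 'a set set \<Rightarrow> 'a \<Rightarrow> 'a \<Rightarrow> enat" where
  "graph_dist V E u v = (INF p\<in>{p. walk_between V E u p v}. enat (length p - 1))"

definition edge_dist :: "'a set \<Rightarrow> 'a set set \<Rightarrow> 'a set \<Rightarrow> 'a set \<Rightarrow> enat" where
  "edge_dist V E e e' = (INF (v, v')\<in>e \<times> e'. graph_dist V E v v')"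

definition connected_graph :: "'a set \<Rightarrow> 'a set set \<Rightarrow> bool" where
  "connected_graph V E \<longleftrightarrow> V \<noteq> {} \<and> (\<forall>u\<in>V. \<forall>v\<in>V. \<exists>p. walk_between V E u p v)"

text \<open>A cycle is the list of its vertices, without repeating the first one at the end.\<close>

definition is_cycle :: "'a set \<Rightarrow> 'a set set \<Rightarrow> 'a list \<Rightarrow> bool" where
  "is_cycle V E p \<longleftrightarrow> is_walk V E p \<and> distinct p \<and> 3 \<le> length p \<and> {last p, hd p} \<in> E"

definition is_tree :: "'a set \<Rightarrow> 'a set set \<Rightarrow> bool" where
  "is_tree V E \<longleftrightarrow> fin_simple_graph V E \<and> connected_graph V E \<and> (\<nexists>p. is_cycle V E p)"

definition r_matching :: "nat \<Rightarrow> 'a set \<Rightarrow> 'a set set \<Rightarrow> 'a set set \<Rightarrow> bool" where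
  "r_matching r V E M \<longleftrightarrow>
     M \<subseteq> E \<and> (\<forall>e\<in>M. \<forall>e'\<in>M. e \<noteq> e' \<longrightarrow> enat r \<le> edge_dist V E e e')"

definition num_r_matchings :: "nat \<Rightarrow> 'a set \<Rightarrow> 'a set set \<Rightarrow> nat" where
  "num_r_matchings r V E = card {M. r_matching r V E M}"

end

theory Submission
  imports Defs
begin

text \<open>
  Fix a tree and count, for a set \<open>A\<close> of active edges, the sets \<open>M \<subseteq> A\<close> any two of whose edges have
  at least \<open>r\<close> active edges strictly between them. Deactivating an edge amounts to deleting it or
  contracting it. With \<open>t = s + 1\<close> and \<open>b = exp (1 / t + 1 / r)\<close> there are at most
  \<open>t * b ^ card A\<close> such sets, by induction on \<open>A\<close>. Take a longest active path, starting at \<open>l\<close>,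
  and the branch point \<open>z\<close> on it closest to \<open>l\<close> from which one reaches distance \<open>r + 1\<close> from \<open>l\<close>
  when leaving the path; let \<open>k\<close> be its distance from \<open>l\<close>. The set \<open>C\<close> of edges hanging off \<open>z\<close> on the
  side of \<open>l\<close> contains at most one edge of \<open>M\<close>. If it contains one at distance \<open>i\<close> from \<open>z\<close>, the ball
  of radius \<open>r / 2 - i\<close> around \<open>z\<close> in the rest of the tree contains no edge of \<open>M\<close> and can be
  contracted without violating the distance condition. This ball contains two arms starting at \<open>z\<close>,
  so the contraction gains a factor \<open>b ^ (- 2 * min (r / 2 - i) (r + 1 - k))\<close>. Summed over \<open>C\<close>,
  the claim becomes an inequality that rests on \<open>t / 2 + Y \<le> t * exp (Y / t - 1 / 2)\<close>; the
  tangency point \<open>Y = t / 2\<close> is where the factor \<open>exp (1 / r)\<close> comes from.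
\<close>

subsection \<open>Edge sets with compatible cuts\<close>

text \<open>
  \<open>R x\<close> is the set of edges separating \<open>x\<close> from a fixed root, so every edge is a cut of \<open>V\<close>;
  the last assumption says that of the four regions formed by two cuts one is empty.
\<close>

locale cut_tree =
  fixes V :: "'a set" and E :: "'b set" and R :: "'a \<Rightarrow> 'b set" and end1 end2 :: "'b \<Rightarrow> 'a"
  assumes finite_V: "finite V" and V_nonempty: "V \<noteq> {}" and finite_E: "finite E"
    and end1_in_V: "e \<in> E \<Longrightarrow> end1 e \<in> V"
    and end2_in_V: "e \<in> E \<Longrightarrow> end2 e \<in> V"
    and edge_separates_ends: "e \<in> E \<Longrightarrow> g \<in> E \<Longrightarrow> (g \<in> R (end1 e)) \<noteq> (g \<in> R (end2 e)) \<longleftrightarrow> g = e"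
    and cuts_compatible: "g \<in> E \<Longrightarrow> h \<in> E \<Longrightarrow> g \<noteq> h \<Longrightarrow>
      \<exists>p q. \<forall>x\<in>V. \<not> ((g \<in> R x) = p \<and> (h \<in> R x) = q)"
begin

text \<open>
  For a set \<open>A\<close> of active edges, \<open>path A x y\<close> and \<open>between A e f\<close> consist of the active edges
  separating \<open>x\<close> from \<open>y\<close>, respectively \<open>e\<close> from \<open>f\<close>; \<open>before A l g\<close> lists those between \<open>l\<close> and \<open>g\<close>.
\<close>

definition path :: "'b set \<Rightarrow> 'a \<Rightarrow> 'a \<Rightarrow> 'b set" where
  "path A x y = {g \<in> A. (g \<in> R x) \<noteq> (g \<in> R y)}"

definition between :: "'b set \<Rightarrow> 'b \<Rightarrow> 'b \<Rightarrow> 'b set" where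
  "between A e f = path A (end1 e) (end1 f) - {e, f}"

definition matching :: "nat \<Rightarrow> 'b set \<Rightarrow> 'b set \<Rightarrow> bool" where
  "matching r A M \<longleftrightarrow> M \<subseteq> A \<and> (\<forall>e\<in>M. \<forall>f\<in>M. e \<noteq> f \<longrightarrow> r \<le> card (between A e f))"

definition before :: "'b set \<Rightarrow> 'a \<Rightarrow> 'b \<Rightarrow> 'b set" where
  "before A l g = path A l (end1 g) - {g}"

lemma finite_matchings: "finite A \<Longrightarrow> finite {M. matching r A M}"
  by (rule finite_subset[of _ "Pow A"]) (auto simp: matching_def)

text \<open>Switching to the other end of an edge changes membership of that edge only, and
  \<open>e\<close> and \<open>f\<close> are removed anyway; so any choice of ends computes
  \<open>between\<close>.\<close>

lemma between_other_ends:
  assumes "A \<subseteq> E" "e \<in> A" "f \<in> A" "v \<in> {end1 e, end2 e}" "v' \<in> {end1 f, end2 f}"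
  shows "between A e f = path A v v' - {e, f}"
proof -
  have "(g \<in> R v) = (g \<in> R (end1 e))" if "g \<in> A" "g \<noteq> e" for g
    using that assms edge_separates_ends[of e g] by auto
  moreover have "(g \<in> R v') = (g \<in> R (end1 f))" if "g \<in> A" "g \<noteq> f" for g
    using that assms edge_separates_ends[of f g] by auto
  ultimately show ?thesis
    unfolding between_def path_def by auto
qed

section \<open>Order of the active edges along the paths from a base point\<close>

context
  fixes A :: "'b set" and l :: 'a
  assumes A: "A \<subseteq> E" and l: "l \<in> V"
begin

lemma finite_A: "finite A"
  using A finite_E finite_subset by blast

lemma finite_path [simp]: "finite (path A x y)"
  using finite_A by (simp add: path_def)

lemma finite_before [simp]: "finite (before A l g)"
  by (simp add: before_def)

text \<open>Otherwise \<open>l\<close>, \<open>u\<close>, \<open>v\<close> and \<open>w\<close>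
  would occupy all four regions formed by the cuts \<open>g\<close> and \<open>h\<close>. The
  arguments below about the shape of paths are reduced to this fact.\<close>

lemma no_crossing:
  assumes "g \<noteq> h" "u \<in> V" "v \<in> V" "w \<in> V"
    "g \<in> path A l u" "h \<in> path A l u" "g \<in> path A l v" "h \<notin> path A l v"
    "g \<notin> path A l w" "h \<in> path A l w"
  shows False
proof -
  have gh: "g \<in> A" "h \<in> A"
    using assms by (auto simp: path_def)
  then obtain p q where pq: "\<forall>x\<in>V. \<not> ((g \<in> R x) = p \<and> (h \<in> R x) = q)"
    using cuts_compatible[of g h] A assms(1) by blast
  show False
    using pq[rule_format, OF l] pq[rule_format, OF assms(2)] pq[rule_format, OF assms(3)]
      pq[rule_format, OF assms(4)] assms(5-) gh
    unfolding path_def by auto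
qed

text \<open>The ends of \<open>g\<close> differ in the cut \<open>g\<close> alone, so exactly one of
  them lies beyond \<open>g\<close> as seen from \<open>l\<close>.\<close>

lemma far_end:
  assumes "g \<in> A"
  obtains v where "v \<in> {end1 g, end2 g}" "v \<in> V" "path A l v = insert g (before A l g)"
proof (cases "g \<in> path A l (end1 g)")
  case True
  then show ?thesis
    using that[of "end1 g"] end1_in_V A assms by (auto simp: before_def)
next
  case False
  have "path A l (end2 g) = insert g (before A l g)"
    using False A assms edge_separates_ends[of g] by (auto simp: before_def path_def)
  then show ?thesis
    using that[of "end2 g"] end2_in_V A assms by auto
qed

lemma near_end:
  assumes "g \<in> A"
  obtains v where "v \<in> {end1 g, end2 g}" "v \<in> V" "path A l v = before A l g"
proof (cases "g \<in> path A l (end1 g)")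
  case False
  then show ?thesis
    using that[of "end1 g"] end1_in_V A assms by (auto simp: before_def)
next
  case True
  have "path A l (end2 g) = before A l g"
    using True A assms edge_separates_ends[of g] by (auto simp: before_def path_def)
  then show ?thesis
    using that[of "end2 g"] end2_in_V A assms by auto
qed

lemma before_end:
  assumes "g \<in> A" "v \<in> {end1 g, end2 g}"
  shows "before A l g = path A l v - {g}"
proof -
  have "(h \<in> R v) = (h \<in> R (end1 g))" if "h \<in> A" "h \<noteq> g" for h
    using that assms A edge_separates_ends[of g h] by auto
  then show ?thesis
    unfolding before_def path_def by auto
qed

lemma not_in_before [simp]: "g \<notin> before A l g"
  by (simp add: before_def)

text \<open>If an edge \<open>x\<close> before \<open>g\<close> were missing from the path to
  \<open>v\<close>, then \<open>x\<close> and \<open>g\<close> would cross, witnessed by the two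
  ends of \<open>g\<close> and by \<open>v\<close>.\<close>

lemma before_subset_path:
  assumes "v \<in> V" "g \<in> path A l v"
  shows "before A l g \<subseteq> path A l v - {g}"
proof
  fix x assume x: "x \<in> before A l g"
  have g: "g \<in> A" using assms(2) by (simp add: path_def)
  obtain n where n: "n \<in> V" "path A l n = before A l g" using near_end[OF g] .
  obtain f where f: "f \<in> V" "path A l f = insert g (before A l g)" using far_end[OF g] .
  have "x \<in> path A l v"
    using no_crossing[of x g f n v] x n f assms by auto
  then show "x \<in> path A l v - {g}" using x by auto
qed

lemma before_strict_mono:
  assumes "g \<in> A" "h \<in> before A l g"
  shows "before A l h \<subset> before A l g"
proof -
  obtain n where n: "n \<in> V" "path A l n = before A l g" using near_end[OF assms(1)] .
  show ?thesis using before_subset_path[of n h] n assms by auto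
qed

lemma before_total:
  assumes "v \<in> V" "g \<in> path A l v" "h \<in> path A l v" "g \<noteq> h"
  shows "g \<in> before A l h \<or> h \<in> before A l g"
proof (rule ccontr)
  assume *: "\<not> ?thesis"
  have gh: "g \<in> A" "h \<in> A" using assms by (auto simp: path_def)
  obtain f where f: "f \<in> V" "path A l f = insert g (before A l g)" using far_end[OF gh(1)] .
  obtain f' where f': "f' \<in> V" "path A l f' = insert h (before A l h)" using far_end[OF gh(2)] .
  show False using no_crossing[of g h v f f'] f f' assms * by auto
qed

lemma inj_on_card_before:
  assumes "v \<in> V"
  shows "inj_on (\<lambda>g. card (before A l g)) (path A l v)"
proof (rule inj_onI, rule ccontr)
  fix g h assume *: "g \<in> path A l v" "h \<in> path A l v"
    "card (before A l g) = card (before A l h)" "g \<noteq> h"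
  have gh: "g \<in> A" "h \<in> A" using * by (auto simp: path_def)
  have "before A l g \<subset> before A l h \<or> before A l h \<subset> before A l g"
    using before_total[OF assms] * before_strict_mono gh by blast
  then show False
    using psubset_card_mono[of "before A l g" "before A l h"]
      psubset_card_mono[of "before A l h" "before A l g"] *(3) by auto
qed

text \<open>\<open>card (before A l g)\<close> is the position of \<open>g\<close> on the path.
  Positions are distinct and smaller than the length, so counting shows that each one
  occurs.\<close>

lemma card_before_image:
  assumes "v \<in> V"
  shows "(\<lambda>g. card (before A l g)) ` path A l v = {..<card (path A l v)}"
proof (rule card_subset_eq)
  show "(\<lambda>g. card (before A l g)) ` path A l v \<subseteq> {..<card (path A l v)}"
  proof
    fix n assume "n \<in> (\<lambda>g. card (before A l g)) ` path A l v"
    then obtain g where g: "g \<in> path A l v" "n = card (before A l g)" by auto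
    have "before A l g \<subset> path A l v" using before_subset_path[OF assms g(1)] g(1) by auto
    then show "n \<in> {..<card (path A l v)}" using g(2) psubset_card_mono[OF finite_path] by simp
  qed
qed (simp_all add: card_image[OF inj_on_card_before[OF assms]])

lemma card_before_less:
  assumes "v \<in> V"
  shows "card {g \<in> path A l v. card (before A l g) < n} = min n (card (path A l v))"
proof -
  let ?S = "{g \<in> path A l v. card (before A l g) < n}"
  have "card ?S = card ((\<lambda>g. card (before A l g)) ` ?S)"
    by (rule card_image[symmetric], rule inj_on_subset[OF inj_on_card_before[OF assms]]) auto
  also have "(\<lambda>g. card (before A l g)) ` ?S = {..<card (path A l v)} \<inter> {..<n}"
    using card_before_image[OF assms] by auto
  also have "\<dots> = {..<min n (card (path A l v))}" by auto
  finally show ?thesis by simp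
qed

text \<open>The parts shared with the path from \<open>l\<close> to \<open>y\<close> are initial
  segments of it, hence form a chain in which size decides inclusion.\<close>

lemma path_inter_chain:
  assumes "y \<in> V" "v \<in> V" "v' \<in> V" "card (path A l v \<inter> path A l y) \<le> card (path A l v' \<inter> path A l y)"
  shows "path A l v \<inter> path A l y \<subseteq> path A l v' \<inter> path A l y"
proof (rule ccontr)
  assume "\<not> ?thesis"
  then obtain g where g: "g \<in> path A l v" "g \<in> path A l y" "g \<notin> path A l v'" by auto
  have "path A l v' \<inter> path A l y \<subseteq> path A l v \<inter> path A l y"
  proof
    fix h assume "h \<in> path A l v' \<inter> path A l y"
    then show "h \<in> path A l v \<inter> path A l y"
      using no_crossing[of g h y v v'] assms(1-3) g by auto
  qed
  then have "path A l v' \<inter> path A l y \<subset> path A l v \<inter> path A l y" using g by auto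
  then show False using psubset_card_mono assms(4)
    by (metis finite_Int finite_path leD)
qed

text \<open>Otherwise the path from \<open>y\<close> to \<open>v\<close> would be longer than the
  one from \<open>l\<close> to \<open>y\<close>.\<close>

lemma card_path_other_base:
  assumes "y \<in> V" "v \<in> V" "\<And>u v. u \<in> V \<Longrightarrow> v \<in> V \<Longrightarrow> card (path A u v) \<le> card (path A l y)"
  shows "card (path A l v - path A l y) \<le> card (path A l v \<inter> path A l y)"
proof -
  have "path A y v = (path A l v - path A l y) \<union> (path A l y - path A l v)"
    by (auto simp: path_def)
  then have "card (path A y v) = card (path A l v - path A l y) + card (path A l y - path A l v)"
    using card_Un_disjoint[of "path A l v - path A l y" "path A l y - path A l v"] by auto
  moreover have "card (path A l y) = card (path A l y - path A l v) + card (path A l v \<inter> path A l y)"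
    by (metis Int_commute add.commute card_Diff_subset_Int card_mono finite_Int finite_path inf_le1 le_add_diff_inverse2)
  ultimately show ?thesis using assms(3)[of y v] assms by linarith
qed

text \<open>
  The active path from \<open>l\<close> to \<open>y\<close> is a longest one. The branch point \<open>z\<close>, where the way to \<open>w\<close> leaves
  it, appears only through \<open>trunk\<close>, the set of active edges between \<open>l\<close> and \<open>z\<close>.
\<close>

context
  fixes y w :: 'a and r k :: nat and C :: "'b set"
  assumes y: "y \<in> V" and w: "w \<in> V"
    and longest: "\<And>u v. u \<in> V \<Longrightarrow> v \<in> V \<Longrightarrow> card (path A u v) \<le> card (path A l y)"
    and w_far: "r + 1 \<le> card (path A l w)"
    and w_least: "\<And>v. v \<in> V \<Longrightarrow> r + 1 \<le> card (path A l v) \<Longrightarrow>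
      k \<le> card (path A l v \<inter> path A l y)"
    and k: "k = card (path A l w \<inter> path A l y)"
    and C: "C = {g \<in> A. \<exists>v\<in>{end1 g, end2 g}. card (path A l v \<inter> path A l y) < k}"
begin

abbreviation (input) "N \<equiv> path A l"
abbreviation (input) "trunk \<equiv> path A l w \<inter> path A l y"

text \<open>\<open>trunk\<close> is the initial segment of length \<open>k\<close> of the path to
  \<open>y\<close>; the inequality says that \<open>v\<close> branches off this path at
  \<open>z\<close> or later.\<close>

lemma trunk_subset_iff:
  assumes "v \<in> V"
  shows "trunk \<subseteq> N v \<longleftrightarrow> k \<le> card (N v \<inter> N y)"
  using path_inter_chain[OF y w assms] k card_mono[of "N v \<inter> N y" "trunk"] by auto

lemma C_subset: "C \<subseteq> A"
  using C by auto

lemma outside_C: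
  assumes "g \<in> A - C" "v \<in> {end1 g, end2 g}"
  shows "trunk \<subseteq> N v"
proof -
  have "v \<in> V" using assms A end1_in_V end2_in_V by auto
  then show ?thesis using assms C trunk_subset_iff[of v] by auto
qed

lemma outside_CI:
  assumes "g \<in> A" "trunk \<subseteq> before A l g"
  shows "g \<notin> C"
proof
  assume "g \<in> C"
  then obtain v where v: "v \<in> {end1 g, end2 g}" "card (N v \<inter> N y) < k" using C by auto
  have "v \<in> V" using v assms A end1_in_V end2_in_V by auto
  moreover have "trunk \<subseteq> N v" using before_end[OF assms(1) v(1)] assms(2) by auto
  ultimately show False using trunk_subset_iff v(2) by auto
qed

lemma trunk_subset_C: "trunk \<subseteq> C"
proof
  fix g assume g: "g \<in> trunk"
  then have gA: "g \<in> A" by (auto simp: path_def)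
  obtain n where n: "n \<in> {end1 g, end2 g}" "n \<in> V" "N n = before A l g" using near_end[OF gA] .
  have "\<not> trunk \<subseteq> N n" using n(3) g by auto
  then show "g \<in> C" using trunk_subset_iff[OF n(2)] n(1) gA C by auto
qed

section \<open>Distances on the side of \<open>l\<close>\<close>

text \<open>Beyond \<open>trunk\<close> the path to \<open>w\<close> has at most \<open>k\<close>
  further edges, by \<open>card_path_other_base\<close>.\<close>

lemma k_ge: "r + 1 \<le> 2 * k"
proof -
  have "card (N w) = k + card (N w - N y)"
    using k card_Int_Diff[of "N w" "N y"] by simp
  then show ?thesis
    using w_far card_path_other_base[OF y w longest] k by simp
qed

text \<open>The point at distance \<open>r + 1\<close> from \<open>l\<close> on the longest path is
  a candidate in the minimisation that selects \<open>w\<close>.\<close>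

lemma k_le: "k \<le> r + 1"
proof -
  have "r < card (N y)" using w_far longest[OF l w] by simp
  then obtain g where g: "g \<in> N y" "card (before A l g) = r"
    using card_before_image[OF y] by (metis imageE lessThan_iff)
  then have gA: "g \<in> A" by (auto simp: path_def)
  obtain v where v: "v \<in> V" "N v = insert g (before A l g)" using far_end[OF gA] .
  have "card (N v) = r + 1" using v(2) g(2) by simp
  moreover have "card (N v \<inter> N y) \<le> card (N v)" by (rule card_mono) auto
  ultimately show ?thesis using w_least[OF v(1)] by simp
qed

text \<open>Let \<open>v\<close> leave the longest path no later than \<open>v'\<close>. The branch
  to \<open>v\<close> is at most as long as the segment from \<open>l\<close> to its branching
  point; replacing it by this segment gives the path from \<open>l\<close> to \<open>v'\<close>,
  which has at most \<open>r\<close> edges by the choice of \<open>w\<close>.\<close>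

lemma dist_below:
  assumes "v \<in> V" "v' \<in> V" "card (N v \<inter> N y) < k" "card (N v' \<inter> N y) < k"
  shows "card (path A v v') \<le> r"
proof -
  have main: "card (path A v v') \<le> r"
    if V: "v \<in> V" "v' \<in> V" and lt: "card (N v' \<inter> N y) < k"
      and le: "card (N v \<inter> N y) \<le> card (N v' \<inter> N y)" for v v'
  proof -
    have sub: "N v \<inter> N y \<subseteq> N v' \<inter> N y" by (rule path_inter_chain[OF y V le])
    have "path A v v' \<subseteq> (N v - N y) \<union> (N v' - N y) \<union> ((N v' \<inter> N y) - (N v \<inter> N y))"
      using sub by (auto simp: path_def)
    then have "card (path A v v') \<le> card ((N v - N y) \<union> (N v' - N y) \<union> ((N v' \<inter> N y) - (N v \<inter> N y)))"
      by (intro card_mono) auto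
    also have "\<dots> \<le> card (N v - N y) + card (N v' - N y) + card ((N v' \<inter> N y) - (N v \<inter> N y))"
      by (meson add_le_mono1 card_Un_le le_trans)
    also have "card ((N v' \<inter> N y) - (N v \<inter> N y)) = card (N v' \<inter> N y) - card (N v \<inter> N y)"
      by (rule card_Diff_subset[OF _ sub]) simp
    also have "card (N v - N y) + card (N v' - N y) + (card (N v' \<inter> N y) - card (N v \<inter> N y))
        \<le> card (N v' - N y) + card (N v' \<inter> N y)"
      using card_path_other_base[OF y V(1) longest] le by simp
    also have "\<dots> = card (N v')" using card_Int_Diff[of "N v'" "N y"] by simp
    also have "\<dots> \<le> r" using w_least[OF V(2)] lt by (cases "r + 1 \<le> card (N v')") auto
    finally show ?thesis .
  qed
  have "path A v v' = path A v' v" by (auto simp: path_def)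
  then show ?thesis using main[of v v'] main[of v' v] assms by (metis nle_le)
qed

text \<open>If both ends of \<open>f\<close> are below \<open>z\<close>, an end can be chosen so
  that \<open>f\<close> itself lies on a path of at most \<open>r\<close> edges, which leaves fewer
  than \<open>r\<close> strictly between. At most one edge of \<open>C\<close> has an end that is
  not below \<open>z\<close>, so this applies to one edge of each pair.\<close>

lemma between_C_less:
  assumes "e \<in> C" "f \<in> C" "e \<noteq> f"
  shows "card (between A e f) < r"
proof -
  have key: "card (between A e f) < r"
    if e: "e \<in> C" and f: "f \<in> C" and both: "\<And>v. v \<in> {end1 f, end2 f} \<Longrightarrow> card (N v \<inter> N y) < k"
      and ef: "e \<noteq> f" for e f
  proof -
    obtain v where v: "v \<in> {end1 e, end2 e}" "card (N v \<inter> N y) < k" using e C by auto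
    have eA: "e \<in> A" "f \<in> A" using e f C by auto
    have V: "v \<in> V" "end1 f \<in> V" "end2 f \<in> V" using v eA A end1_in_V end2_in_V by auto
    obtain v' where v': "v' \<in> {end1 f, end2 f}" "f \<in> path A v v'"
      using edge_separates_ends[of f f] eA A by (auto simp: path_def)
    have "between A e f \<subseteq> path A v v' - {f}"
      using between_other_ends[OF A eA v(1) v'(1)] by auto
    then have "card (between A e f) \<le> card (path A v v' - {f})" by (intro card_mono) auto
    also have "\<dots> < card (path A v v')" using v'(2) by (intro card_Diff1_less) auto
    also have "\<dots> \<le> r" using dist_below[of v v'] V v v' both by blast
    finally show ?thesis .
  qed
  \<comment> \<open>Such an edge is the last edge of the trunk.\<close>
  have top: "g \<in> trunk \<and> (\<exists>v\<in>V. N v \<inter> N y = trunk - {g})"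
    if g: "g \<in> C" and u: "u \<in> {end1 g, end2 g}" "\<not> card (N u \<inter> N y) < k" for g u
  proof -
    obtain v where v: "v \<in> {end1 g, end2 g}" "card (N v \<inter> N y) < k" using g C by auto
    have gA: "g \<in> A" using g C by auto
    have V: "v \<in> V" "u \<in> V" using v u gA A end1_in_V end2_in_V by auto
    have sub: "trunk \<subseteq> N u" "\<not> trunk \<subseteq> N v" using trunk_subset_iff V v u by auto
    have eq: "N u - {g} = N v - {g}" using before_end[OF gA u(1)] before_end[OF gA v(1)] by simp
    have gt: "g \<in> trunk" "g \<notin> N v" using sub eq by blast+
    have "N v \<inter> N y \<subseteq> trunk" using path_inter_chain[OF y V(1) w] v(2) k by simp
    then have "N v \<inter> N y = trunk - {g}" using sub eq gt by blast
    then show ?thesis using gt V by blast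
  qed
  have sym: "between A e f = between A f e" by (auto simp: between_def path_def)
  show ?thesis
  proof (rule ccontr)
    assume neg: "\<not> ?thesis"
    obtain v where v: "v \<in> {end1 f, end2 f}" "\<not> card (N v \<inter> N y) < k"
      using key[OF assms(1,2) _ assms(3)] neg by blast
    obtain u where u: "u \<in> {end1 e, end2 e}" "\<not> card (N u \<inter> N y) < k"
      using key[OF assms(2,1) _ assms(3)[symmetric]] neg sym by auto
    obtain v' where v': "f \<in> trunk" "v' \<in> V" "N v' \<inter> N y = trunk - {f}"
      using top[OF assms(2) v] by blast
    obtain u' where u': "e \<in> trunk" "u' \<in> V" "N u' \<inter> N y = trunk - {e}"
      using top[OF assms(1) u] by blast
    have "card (N v' \<inter> N y) = card (N u' \<inter> N y)" using v' u' by simp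
    then have "trunk - {f} \<subseteq> trunk - {e}"
      using path_inter_chain[OF y v'(2) u'(2)] v' u' by simp
    then show False using v' u' assms(3) by blast
  qed
qed

text \<open>An edge \<open>g\<close> of \<open>C\<close> on the path would cross a trunk edge
  \<open>h\<close> that is not on the way to \<open>g\<close>, witnessed by \<open>v\<close>,
  \<open>v'\<close> and the far end of \<open>g\<close>.\<close>

lemma between_avoids_C:
  assumes "v \<in> V" "v' \<in> V" "trunk \<subseteq> N v" "trunk \<subseteq> N v'"
  shows "path A v v' \<inter> C = {}"
proof (rule ccontr)
  assume "\<not> ?thesis"
  then obtain g where g: "g \<in> path A v v'" "g \<in> C" by auto
  then have gA: "g \<in> A" using C by auto
  obtain u where u: "u \<in> {end1 g, end2 g}" "card (N u \<inter> N y) < k" using g C by auto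
  have uV: "u \<in> V" using u gA A end1_in_V end2_in_V by auto
  obtain f where f: "f \<in> {end1 g, end2 g}" "f \<in> V" "N f = insert g (before A l g)" using far_end[OF gA] .
  have gt: "g \<notin> trunk" using g(1) assms by (auto simp: path_def)
  have eq: "N f - {g} = N u - {g}" using before_end[OF gA f(1)] before_end[OF gA u(1)] by simp
  obtain h where h: "h \<in> trunk" "h \<notin> N u" using trunk_subset_iff[OF uV] u(2) by auto
  have hf: "h \<notin> N f" "h \<noteq> g" using h eq gt by blast+
  have sep: "g \<in> N v \<and> g \<notin> N v' \<or> g \<in> N v' \<and> g \<notin> N v" using g(1) gA by (auto simp: path_def)
  show False
    using no_crossing[of g h v f v'] no_crossing[of g h v' f v] sep hf h f assms by auto
qed

text \<open>The distance from \<open>z\<close> to the closer end of \<open>e\<close>, and the ball of radius \<open>m\<close> around \<open>z\<close> outside \<open>C\<close>.\<close>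

definition branch_dist :: "'b \<Rightarrow> nat" where
  "branch_dist e = card ((trunk - N (end1 e)) \<union> (N (end1 e) - trunk) - {e})"

definition ball :: "nat \<Rightarrow> 'b set" where
  "ball m = {f \<in> A - C. card (before A l f) < k + m}"

section \<open>Distances through the branch point and contraction of balls\<close>

lemma trunk_subset_before:
  assumes "f \<in> A - C"
  shows "trunk \<subseteq> before A l f"
  using outside_C[OF assms, of "end1 f"] trunk_subset_C assms by (auto simp: before_def)

lemma k_le_card_before: "f \<in> A - C \<Longrightarrow> k \<le> card (before A l f)"
  using card_mono[OF _ trunk_subset_before] k by simp

text \<open>Triangle inequality through \<open>z\<close>: the distance from \<open>z\<close> to
  \<open>f\<close> is \<open>card (before A l f) - k\<close>.\<close>

lemma card_between_C_le:
  assumes "e \<in> C" "f \<in> A - C"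
  shows "card (between A e f) + k \<le> branch_dist e + card (before A l f)"
proof -
  have "between A e f \<subseteq> ((trunk - N (end1 e)) \<union> (N (end1 e) - trunk) - {e}) \<union> (before A l f - trunk)"
    using outside_C[OF assms(2), of "end1 f"] by (auto simp: between_def before_def path_def)
  then have "card (between A e f) \<le> card (((trunk - N (end1 e)) \<union> (N (end1 e) - trunk) - {e}) \<union> (before A l f - trunk))"
    by (intro card_mono) auto
  also have "\<dots> \<le> branch_dist e + card (before A l f - trunk)"
    unfolding branch_dist_def by (rule card_Un_le)
  also have "card (before A l f - trunk) = card (before A l f) - k"
    using card_Diff_subset[of trunk "before A l f"] trunk_subset_before[OF assms(2)] k by simp
  finally have "card (between A e f) \<le> branch_dist e + (card (before A l f) - k)" .
  then show ?thesis using k_le_card_before[OF assms(2)] by simp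
qed

text \<open>A path that misses the ball loses nothing. Otherwise \<open>f\<close> and
  \<open>f'\<close> are at distance at least \<open>r - i\<close> from \<open>z\<close>, their paths
  share nothing outside \<open>trunk\<close> and the ball, and each loses at most \<open>m\<close>
  edges beyond \<open>z\<close>; what remains is at least \<open>2 * (r - r div 2)\<close>.\<close>

lemma between_contracted:
  assumes f: "f \<in> A - C" "f' \<in> A - C" "f \<noteq> f'" and sep: "r \<le> card (between A f f')"
    and far: "r + k \<le> i + card (before A l f)" "r + k \<le> i + card (before A l f')"
    and m: "m = r div 2 - i"
  shows "r \<le> card (between (A - C - ball m) f f')"
proof -
  have fA: "f \<in> A" "f' \<in> A" using f by auto
  obtain v where v: "v \<in> {end1 f, end2 f}" "v \<in> V" "N v = insert f (before A l f)" using far_end[OF fA(1)] .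
  obtain v' where v': "v' \<in> {end1 f', end2 f'}" "v' \<in> V" "N v' = insert f' (before A l f')" using far_end[OF fA(2)] .
  have bt: "between A f f' = path A v v' - {f, f'}" by (rule between_other_ends[OF A fA v(1) v'(1)])
  have "path A v v' \<inter> C = {}"
    using between_avoids_C[OF v(2) v'(2)] outside_C[OF f(1) v(1)] outside_C[OF f(2) v'(1)] by blast
  then have eq: "between (A - C - ball m) f f' = between A f f' - ball m"
    using bt by (auto simp: between_def path_def)
  show ?thesis
  proof (cases "between A f f' \<inter> ball m = {}")
    case True
    then have "between A f f' - ball m = between A f f'" by auto
    then show ?thesis using eq sep by simp
  next
    case False
    then obtain g where g: "g \<in> path A v v'" "g \<noteq> f" "g \<noteq> f'" "g \<in> ball m" using bt by auto
    have gA: "g \<in> A" and g_near: "card (before A l g) < k + m" using g by (auto simp: ball_def)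
    have "k \<le> card (before A l g)" using g k_le_card_before by (auto simp: ball_def)
    \<comment> \<open>The ball contains \<open>g\<close>, so \<open>m\<close> is positive and the
      subtraction in its definition is not truncated.\<close>
    then have mi: "m + i = r div 2" using g_near m by simp
    \<comment> \<open>The edge \<open>g\<close> lies on only one of the two paths, so a shared edge
      \<open>h\<close> comes before \<open>g\<close> and is closer to \<open>z\<close>.\<close>
    have common: "h \<in> ball m \<union> trunk" if h: "h \<in> N v" "h \<in> N v'" for h
    proof (rule ccontr)
      assume hn: "h \<notin> ball m \<union> trunk"
      have hA: "h \<in> A" using h by (auto simp: path_def)
      obtain u where u: "u \<in> V" "N u = insert g (before A l g)" using far_end[OF gA] .
      have hg: "h \<noteq> g" using hn g by auto
      have "g \<in> N v \<and> g \<notin> N v' \<or> g \<in> N v' \<and> g \<notin> N v" using g(1) gA by (auto simp: path_def)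
      then have "h \<in> N u"
        using no_crossing[of g h v u v'] no_crossing[of g h v' u v] u v v' h hg by auto
      then have hb: "h \<in> before A l g" using u hg by auto
      then have "card (before A l h) < card (before A l g)"
        using before_strict_mono[OF gA] psubset_card_mono[OF finite_before] by blast
      then have "h \<in> C" using hn g_near hA by (auto simp: ball_def)
      have "path A v l \<inter> C \<subseteq> trunk"
      proof -
        have "path A v w \<inter> C = {}"
          using between_avoids_C[OF v(2) w] outside_C[OF f(1) v(1)] by blast
        moreover have "path A v y \<inter> C = {}"
          using between_avoids_C[OF v(2) y] outside_C[OF f(1) v(1)] by blast
        ultimately show ?thesis by (auto simp: path_def)
      qed
      then show False using \<open>h \<in> C\<close> h hn by (auto simp: path_def)
    qed
    \<comment> \<open>Edges of \<open>trunk\<close> and of the ball have positions below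
      \<open>k + m\<close>, and a path has one edge per position.\<close>
    have count: "card (before A l u) \<le> k + m + card (before A l u - (trunk \<union> ball m))"
      if u: "u \<in> A" for u
    proof -
      obtain n where n: "n \<in> V" "N n = before A l u" using near_end[OF u] .
      have "before A l u \<inter> (trunk \<union> ball m) \<subseteq> {g \<in> N n. card (before A l g) < k + m}"
      proof
        fix g assume g: "g \<in> before A l u \<inter> (trunk \<union> ball m)"
        have "card (before A l g) < k" if "g \<in> trunk"
        proof -
          have "before A l g \<subset> trunk"
            using before_subset_path[OF w] before_subset_path[OF y] that by blast
          then show ?thesis using k psubset_card_mono[of trunk] by simp
        qed
        then show "g \<in> {g \<in> N n. card (before A l g) < k + m}" using g n by (auto simp: ball_def)
      qed
      then have "card (before A l u \<inter> (trunk \<union> ball m)) \<le> k + m"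
        using card_mono[of "{g \<in> N n. card (before A l g) < k + m}"] card_before_less[OF n(1), of "k + m"]
        by fastforce
      then show ?thesis
        using card_Int_Diff[of "before A l u" "trunk \<union> ball m"] by simp
    qed
    let ?X = "before A l f - (trunk \<union> ball m)" and ?X' = "before A l f' - (trunk \<union> ball m)"
    have fb: "f \<notin> trunk" "f' \<notin> trunk" "f \<notin> ball m" "f' \<notin> ball m"
      using f trunk_subset_C far mi by (auto simp: ball_def)
    have "?X \<inter> ?X' = {}" using common v(3) v'(3) by blast
    moreover have "?X \<union> ?X' \<subseteq> between A f f' - ball m"
    proof -
      have "h \<in> path A v v'" if "h \<in> N v" "h \<notin> N v'" for h using that by (auto simp: path_def)
      moreover have "h \<in> path A v v'" if "h \<in> N v'" "h \<notin> N v" for h using that by (auto simp: path_def)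
      moreover have "f \<notin> N v'" "f' \<notin> N v" using common v(3) v'(3) fb by blast+
      ultimately show ?thesis unfolding bt using common v(3) v'(3) by fastforce
    qed
    ultimately have "card ?X + card ?X' \<le> card (between A f f' - ball m)"
      using card_Un_disjoint[of ?X ?X'] card_mono[of "between A f f' - ball m" "?X \<union> ?X'"] bt by simp
    then show ?thesis
      unfolding eq using count[OF fA(1)] count[OF fA(2)] far mi by linarith
  qed
qed

text \<open>Beyond \<open>trunk\<close>, the paths to \<open>w\<close> and \<open>y\<close> are
  disjoint arms with at least \<open>r + 1 - k\<close> edges each, and the ball contains the first
  \<open>m\<close> edges of each arm, or the whole arm.\<close>

lemma card_ball_ge: "2 * min m (r + 1 - k) \<le> card (ball m)"
proof -
  have arm: "min m (r + 1 - k) \<le> card (ball m \<inter> (N v - trunk)) "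
    if v: "v \<in> V" "v' \<in> V" "trunk = N v \<inter> N v'" "r + 1 \<le> card (N v)" for v v'
  proof -
    let ?S = "{g \<in> N v. card (before A l g) < k + m}"
    have "?S - trunk \<subseteq> ball m \<inter> (N v - trunk)"
    proof
      fix g assume g: "g \<in> ?S - trunk"
      then have gA: "g \<in> A" by (auto simp: path_def)
      obtain u where u: "u \<in> V" "N u = insert g (before A l g)" using far_end[OF gA] .
      have "trunk \<subseteq> before A l g"
      proof
        fix h assume h: "h \<in> trunk"
        then have "h \<in> N u" using no_crossing[of g h v u v'] v u g by auto
        then show "h \<in> before A l g" using u g h by auto
      qed
      then show "g \<in> ball m \<inter> (N v - trunk)" using outside_CI gA g by (auto simp: ball_def)
    qed
    then have "card (?S - trunk) \<le> card (ball m \<inter> (N v - trunk))"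
      by (intro card_mono) auto
    moreover have "card ?S - k \<le> card (?S - trunk)" using diff_card_le_card_Diff[of trunk ?S] k by simp
    ultimately show ?thesis using card_before_less[OF v(1), of "k + m"] v(4) by simp
  qed
  have "min m (r + 1 - k) \<le> card (ball m \<inter> (N w - trunk))" by (rule arm[OF w y refl w_far])
  moreover have "min m (r + 1 - k) \<le> card (ball m \<inter> (N y - trunk))"
    using arm[OF y w] w_far longest[OF l w] by (simp add: Int_commute)
  moreover have "card (ball m \<inter> (N w - trunk)) + card (ball m \<inter> (N y - trunk)) \<le> card (ball m)"
  proof -
    have "card (ball m \<inter> (N w - trunk)) + card (ball m \<inter> (N y - trunk))
        = card (ball m \<inter> (N w - trunk) \<union> ball m \<inter> (N y - trunk))"
      by (rule card_Un_disjoint[symmetric]) auto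
    also have "\<dots> \<le> card (ball m)"
      using finite_A by (intro card_mono) (auto simp: ball_def)
    finally show ?thesis .
  qed
  ultimately show ?thesis by simp
qed

text \<open>The trunk is a path ending at \<open>z\<close>, so its edges realise each distance from
  0 to \<open>k - 1\<close> once.\<close>

lemma sum_branch_dist_trunk: "(\<Sum>e\<in>trunk. F (branch_dist e)) = (\<Sum>i<k. F i :: real)"
proof -
  have sub: "before A l e \<subseteq> trunk - {e}" if "e \<in> trunk" for e
    using before_subset_path[OF w] before_subset_path[OF y] that by blast
  have bd: "branch_dist e = k - Suc (card (before A l e))" if e: "e \<in> trunk" for e
  proof -
    have "(trunk - N (end1 e)) \<union> (N (end1 e) - trunk) - {e} = trunk - insert e (before A l e)"
      using sub[OF e] unfolding before_def by blast
    moreover have "card (trunk - insert e (before A l e)) = k - card (insert e (before A l e))"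
      unfolding k using sub[OF e] e by (intro card_Diff_subset) auto
    ultimately show ?thesis by (simp add: branch_dist_def)
  qed
  have inj: "inj_on (\<lambda>e. card (before A l e)) trunk"
    by (rule inj_on_subset[OF inj_on_card_before[OF w]]) auto
  have img: "(\<lambda>e. card (before A l e)) ` trunk = {..<k}"
  proof (rule card_subset_eq)
    show "(\<lambda>e. card (before A l e)) ` trunk \<subseteq> {..<k}"
    proof
      fix n assume "n \<in> (\<lambda>e. card (before A l e)) ` trunk"
      then obtain e where e: "e \<in> trunk" "n = card (before A l e)" by auto
      have "before A l e \<subset> trunk" using sub[OF e(1)] e(1) by auto
      then show "n \<in> {..<k}" using e(2) psubset_card_mono[of trunk] k by simp
    qed
  qed (simp_all add: card_image[OF inj] k)
  have "(\<Sum>e\<in>trunk. F (branch_dist e)) = (\<Sum>e\<in>trunk. F (k - Suc (card (before A l e))))"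
    using bd by simp
  also have "\<dots> = (\<Sum>b<k. F (k - Suc b))"
    using sum.reindex[OF inj, of "\<lambda>b. F (k - Suc b)"] img by simp
  also have "\<dots> = (\<Sum>i<k. F i)" by (rule sum.nat_diff_reindex)
  finally show ?thesis .
qed

text \<open>A matching avoids \<open>C\<close> or contains exactly one edge \<open>e\<close> of
  \<open>C\<close>. In the second case its other edges are far from \<open>z\<close>, and
  \<open>between_contracted\<close> with \<open>i = branch_dist e\<close> keeps them a matching
  after the contraction.\<close>

lemma matchings_recursion:
  "card {M. matching r A M} \<le> card {M. matching r (A - C) M} +
     (\<Sum>e\<in>C. card {M. matching r (A - C - ball (r div 2 - branch_dist e)) M})"
proof -
  let ?B = "\<lambda>e. A - C - ball (r div 2 - branch_dist e)"
  have fC: "finite C" using C_subset finite_A finite_subset by blast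
  have fin: "finite {M. matching r B M}" if "B \<subseteq> A" for B
    using finite_matchings finite_A finite_subset that by blast
  have sub: "{M. matching r A M} \<subseteq>
      {M. matching r (A - C) M} \<union> (\<Union>e\<in>C. insert e ` {M. matching r (?B e) M})"
  proof
    fix M assume "M \<in> {M. matching r A M}"
    then have M: "M \<subseteq> A" "\<And>e f. e \<in> M \<Longrightarrow> f \<in> M \<Longrightarrow> e \<noteq> f \<Longrightarrow> r \<le> card (between A e f)"
      by (auto simp: matching_def)
    have bC: "between (A - C) e f = between A e f" if "e \<in> A - C" "f \<in> A - C" for e f
    proof -
      have "end1 e \<in> V" "end1 f \<in> V" using that A end1_in_V by auto
      then have "path A (end1 e) (end1 f) \<inter> C = {}"
        using between_avoids_C outside_C that by blast
      then show ?thesis by (auto simp: between_def path_def)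
    qed
    show "M \<in> {M. matching r (A - C) M} \<union> (\<Union>e\<in>C. insert e ` {M. matching r (?B e) M})"
    proof (cases "M \<inter> C = {}")
      case True
      then have "M \<subseteq> A - C" using M by auto
      then have "matching r (A - C) M" using M bC unfolding matching_def by (simp add: subset_iff)
      then show ?thesis by simp
    next
      case False
      then obtain e where e: "e \<in> M" "e \<in> C" by auto
      have only: "f \<in> A - C" if "f \<in> M - {e}" for f
        using between_C_less[OF e(2), of f] M that e by (metis Diff_iff insertCI leD subsetD)
      have far: "r + k \<le> branch_dist e + card (before A l f)" if "f \<in> M - {e}" for f
        using card_between_C_le[OF e(2) only[OF that]] M(2)[OF e(1), of f] that by auto
      have notball: "f \<notin> ball (r div 2 - branch_dist e)" if "f \<in> M - {e}" for f
        using far[OF that] k_le_card_before[OF only[OF that]] by (auto simp: ball_def)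
      have "matching r (?B e) (M - {e})"
        unfolding matching_def
      proof (intro conjI ballI impI)
        show "M - {e} \<subseteq> ?B e" using only notball by auto
        fix f g assume fg: "f \<in> M - {e}" "g \<in> M - {e}" "f \<noteq> g"
        show "r \<le> card (between (?B e) f g)"
          using between_contracted[OF only[OF fg(1)] only[OF fg(2)] fg(3) _ far[OF fg(1)] far[OF fg(2)] refl]
            M(2)[of f g] fg by auto
      qed
      moreover have "M = insert e (M - {e})" using e by auto
      ultimately show ?thesis using e(2) by blast
    qed
  qed
  have "card {M. matching r A M} \<le> card ({M. matching r (A - C) M} \<union> (\<Union>e\<in>C. insert e ` {M. matching r (?B e) M}))"
    by (intro card_mono[OF _ sub] finite_UnI finite_UN_I fC finite_imageI fin) auto
  also have "\<dots> \<le> card {M. matching r (A - C) M} + card (\<Union>e\<in>C. insert e ` {M. matching r (?B e) M})"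
    by (rule card_Un_le)
  also have "card (\<Union>e\<in>C. insert e ` {M. matching r (?B e) M}) \<le> (\<Sum>e\<in>C. card (insert e ` {M. matching r (?B e) M}))"
    by (rule card_UN_le[OF fC])
  also have "\<dots> \<le> (\<Sum>e\<in>C. card {M. matching r (?B e) M})"
    by (intro sum_mono card_image_le fin) auto
  finally show ?thesis by simp
qed

end
end

section \<open>Induction on the set of active edges\<close>

text \<open>Two distinct edges have fewer than \<open>r\<close> edges between them, so a matching
  has at most one edge.\<close>

lemma card_matchings_small_diameter:
  assumes A: "A \<subseteq> E" and small: "\<And>u v. u \<in> V \<Longrightarrow> v \<in> V \<Longrightarrow> card (path A u v) \<le> r"
  shows "card {M. matching r A M} \<le> 1 + card A"
proof -
  have fA: "finite A" using A finite_E finite_subset by blast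
  have close: "card (between A e f) < r" if ef: "e \<in> A" "f \<in> A" "e \<noteq> f" for e f
  proof -
    obtain v where v: "v \<in> {end1 e, end2 e}" "e \<in> path A v (end1 f)"
      using edge_separates_ends[of e e] ef A by (auto simp: path_def)
    have V: "v \<in> V" "end1 f \<in> V" using v ef A end1_in_V end2_in_V by auto
    have "between A e f \<subset> path A v (end1 f)"
      using between_other_ends[OF A ef(1,2) v(1), of "end1 f"] v(2) by auto
    then have "card (between A e f) < card (path A v (end1 f))"
      using fA by (intro psubset_card_mono) (auto simp: path_def)
    then show ?thesis using small[OF V] by simp
  qed
  have "{M. matching r A M} \<subseteq> insert {} ((\<lambda>e. {e}) ` A)"
  proof
    fix M assume "M \<in> {M. matching r A M}"
    then have M: "M \<subseteq> A" "\<And>e f. e \<in> M \<Longrightarrow> f \<in> M \<Longrightarrow> e \<noteq> f \<Longrightarrow> r \<le> card (between A e f)"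
      by (auto simp: matching_def)
    have "e = f" if "e \<in> M" "f \<in> M" for e f
      using M close that by (meson leD subsetD)
    then have "M = {} \<or> (\<exists>e. M = {e})" by blast
    then show "M \<in> insert {} ((\<lambda>e. {e}) ` A)" using M by auto
  qed
  then have "card {M. matching r A M} \<le> card (insert {} ((\<lambda>e. {e}) ` A))"
    using fA by (intro card_mono) auto
  also have "\<dots> \<le> 1 + card ((\<lambda>e. {e}) ` A)" using fA by (simp add: card_insert_if)
  also have "\<dots> \<le> 1 + card A" using fA by (simp add: card_image_le)
  finally show ?thesis .
qed

text \<open>\<open>step\<close> is what remains of the recursion after division by
  \<open>t * b ^ (card A - card C)\<close>: the 1 stands for the matchings avoiding
  \<open>C\<close>, \<open>y\<close> for the edges of \<open>C\<close> outside the trunk, each of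
  weight at most 1, and the sum for the trunk edges, weighted by the two-arm bound.
  \<open>base\<close> settles sets of small diameter.\<close>

theorem card_matchings_le:
  fixes t b :: real
  assumes t: "0 \<le> t" and b: "1 \<le> b"
    and base: "\<And>m::nat. 1 + real m \<le> t * b ^ m"
    and step: "\<And>k y::nat. r + 1 \<le> 2 * k \<Longrightarrow> k \<le> r + 1 \<Longrightarrow>
      1 + real y + (\<Sum>i<k. (1 / b) ^ (2 * min (r div 2 - i) (r + 1 - k))) \<le> b ^ (k + y)"
    and "A \<subseteq> E"
  shows "real (card {M. matching r A M}) \<le> t * b ^ card A"
  using \<open>A \<subseteq> E\<close>
proof (induction "card A" arbitrary: A rule: less_induct)
  case less
  note A = less.prems
  have fA: "finite A" using A finite_E finite_subset by blast
  show ?case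
  proof (cases "\<forall>u\<in>V. \<forall>v\<in>V. card (path A u v) \<le> r")
    case True
    then have "card {M. matching r A M} \<le> 1 + card A"
      using card_matchings_small_diameter[OF A] by blast
    then have "real (card {M. matching r A M}) \<le> 1 + real (card A)" by linarith
    then show ?thesis using base[of "card A"] by linarith
  next
    case False
    have "finite ((\<lambda>(u, v). card (path A u v)) ` (V \<times> V))" using finite_V by simp
    moreover have "(\<lambda>(u, v). card (path A u v)) ` (V \<times> V) \<noteq> {}" using V_nonempty by simp
    ultimately have "Max ((\<lambda>(u, v). card (path A u v)) ` (V \<times> V)) \<in> (\<lambda>(u, v). card (path A u v)) ` (V \<times> V)"
      by (rule Max_in)
    then obtain l y where ly: "l \<in> V" "y \<in> V"
      "card (path A l y) = Max ((\<lambda>(u, v). card (path A u v)) ` (V \<times> V))" by auto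
    have longest: "card (path A u v) \<le> card (path A l y)" if "u \<in> V" "v \<in> V" for u v
      unfolding ly(3) using finite_V that by (intro Max_ge) auto
    have "r + 1 \<le> card (path A l y)" using False longest by (force simp: not_le)
    then have ex: "\<exists>v. v \<in> V \<and> r + 1 \<le> card (path A l v)" using ly by blast
    obtain w where w: "w \<in> V" "r + 1 \<le> card (path A l w)"
      and w_least: "\<And>v. v \<in> V \<Longrightarrow> r + 1 \<le> card (path A l v) \<Longrightarrow>
        card (path A l w \<inter> path A l y) \<le> card (path A l v \<inter> path A l y)"
      using ex_has_least_nat[of "\<lambda>v. v \<in> V \<and> r + 1 \<le> card (path A l v)" _ "\<lambda>v. card (path A l v \<inter> path A l y)"]
        ex by blast
    define k where "k = card (path A l w \<inter> path A l y)"
    define C where "C = {g \<in> A. \<exists>v\<in>{end1 g, end2 g}. card (path A l v \<inter> path A l y) < k}"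
    note ctx = A ly(1,2) w(1) longest w(2) w_least[folded k_def] k_def C_def
    define K where "K e = ball A l k C (r div 2 - branch_dist A l y w e)" for e
    define T where "T = path A l w \<inter> path A l y"
    have T: "T \<subseteq> C" "card T = k" unfolding T_def k_def using trunk_subset_C[OF ctx] by auto
    have k: "r + 1 \<le> 2 * k" "k \<le> r + 1" using k_ge[OF ctx] k_le[OF ctx] by auto
    have CA: "C \<subseteq> A" by (auto simp: C_def)
    then have fC: "finite C" using fA finite_subset by blast
    have "card C \<ge> k" using card_mono[OF fC T(1)] T(2) by simp
    then have C_ne: "0 < card C" using k by simp
    let ?n = "card A - card C"
    have cAC: "card (A - C) = ?n" using card_Diff_subset[OF fC CA] .
    have cC: "card C \<le> card A" using card_mono[OF fA CA] .
    have K: "K e \<subseteq> A - C" for e by (auto simp: K_def ball_def[OF ctx])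
    have b0: "0 < b" using b by simp
    have IH1: "real (card {M. matching r (A - C) M}) \<le> t * b ^ ?n"
      using less.hyps[of "A - C"] cAC C_ne cC A by auto
    have IH2: "real (card {M. matching r (A - C - K e) M}) \<le> t * b ^ ?n * (1 / b) ^ card (K e)" for e
    proof -
      have "card (A - C - K e) = ?n - card (K e)"
        using card_Diff_subset[OF finite_subset[OF K] K] fA cAC by simp
      moreover have "card (K e) \<le> ?n" using card_mono[OF _ K] fA cAC by simp
      ultimately have "b ^ card (A - C - K e) = b ^ ?n * (1 / b) ^ card (K e)"
        using power_diff[of b "card (K e)" ?n] b0 by (simp add: power_divide)
      moreover have "card (A - C - K e) < card A"
        using \<open>card (A - C - K e) = _\<close> C_ne cC by linarith
      ultimately show ?thesis using less.hyps[of "A - C - K e"] A by (simp add: subset_iff mult.assoc)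
    qed
    have weights: "(\<Sum>e\<in>C. (1 / b) ^ card (K e)) \<le>
        real (card C - k) + (\<Sum>i<k. (1 / b) ^ (2 * min (r div 2 - i) (r + 1 - k)))"
    proof -
      have "(\<Sum>e\<in>C. (1 / b) ^ card (K e)) = (\<Sum>e\<in>C - T. (1 / b) ^ card (K e)) + (\<Sum>e\<in>T. (1 / b) ^ card (K e))"
        by (rule sum.subset_diff[OF T(1) fC])
      moreover have "(\<Sum>e\<in>C - T. (1 / b) ^ card (K e)) \<le> (\<Sum>e\<in>C - T. 1)"
        using b by (intro sum_mono power_le_one) auto
      moreover have "(\<Sum>e\<in>C - T. 1::real) = real (card C - k)"
        using card_Diff_subset[OF finite_subset[OF T(1) fC] T(1)] T(2) by simp
      moreover have "(\<Sum>e\<in>T. (1 / b) ^ card (K e))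
          \<le> (\<Sum>e\<in>T. (1 / b) ^ (2 * min (r div 2 - branch_dist A l y w e) (r + 1 - k)))"
        using b card_ball_ge[OF ctx] by (intro sum_mono power_decreasing) (auto simp: K_def)
      moreover have "\<dots> = (\<Sum>i<k. (1 / b) ^ (2 * min (r div 2 - i) (r + 1 - k)))"
        unfolding T_def by (rule sum_branch_dist_trunk[OF ctx])
      ultimately show ?thesis by linarith
    qed
    have "real (card {M. matching r A M}) \<le>
        real (card {M. matching r (A - C) M} + (\<Sum>e\<in>C. card {M. matching r (A - C - K e) M}))"
      using matchings_recursion[OF ctx] unfolding K_def of_nat_le_iff .
    also have "\<dots> \<le> t * b ^ ?n + (\<Sum>e\<in>C. t * b ^ ?n * (1 / b) ^ card (K e))"
      using IH1 IH2 by (simp add: add_mono sum_mono)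
    also have "\<dots> = t * b ^ ?n * (1 + (\<Sum>e\<in>C. (1 / b) ^ card (K e)))"
      by (simp add: distrib_left sum_distrib_left)
    also have "\<dots> \<le> t * b ^ ?n * b ^ card C"
    proof (rule mult_left_mono)
      have "1 + real (card C - k) + (\<Sum>i<k. (1 / b) ^ (2 * min (r div 2 - i) (r + 1 - k))) \<le> b ^ card C"
        using step[OF k, of "card C - k"] \<open>card C \<ge> k\<close> by simp
      then show "1 + (\<Sum>e\<in>C. (1 / b) ^ card (K e)) \<le> b ^ card C" using weights by linarith
    qed (use t b0 in simp)
    also have "\<dots> = t * b ^ card A" using cC by (simp add: power_add[symmetric])
    finally show ?thesis .
  qed
qed

end

subsection \<open>Trees\<close>

text \<open>
  Invariant of growing a spanning tree \<open>(S, F)\<close> edge by edge. In a tree the process ends with all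
  edges, since an edge left over would close a cycle with the distinct walk between its ends.
\<close>

locale spanning_cuts =
  fixes S :: "'a set" and F :: "'a set set" and R :: "'a \<Rightarrow> 'a set set"
  assumes finite_S: "finite S" and finite_F: "finite F" and card_S: "card S = Suc (card F)"
    and R_subset: "x \<in> S \<Longrightarrow> R x \<subseteq> F"
    and ends: "e \<in> F \<Longrightarrow> \<exists>a b. a \<in> S \<and> b \<in> S \<and> e = {a, b} \<and> sym_diff (R a) (R b) = {e}"
    and compatible: "g \<in> F \<Longrightarrow> h \<in> F \<Longrightarrow> g \<noteq> h \<Longrightarrow>
      \<exists>p q. \<forall>x\<in>S. \<not> ((g \<in> R x) = p \<and> (h \<in> R x) = q)"
    and walks: "u \<in> S \<Longrightarrow> v \<in> S \<Longrightarrow> \<exists>p. walk_between S F u p v \<and> distinct p \<and>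
      length p = Suc (card (sym_diff (R u) (R v)))"

section \<open>Walks and the growth of a spanning tree\<close>

lemma is_walk_Cons:
  "p \<noteq> [] \<Longrightarrow> is_walk V E (x # p) \<longleftrightarrow> x \<in> V \<and> {x, hd p} \<in> E \<and> is_walk V E p"
  by (cases p) (auto simp: is_walk_def nth_Cons split: nat.splits)

lemma is_walk_rev: "is_walk V E p \<Longrightarrow> is_walk V E (rev p)"
proof -
  assume p: "is_walk V E p"
  have "{rev p ! i, rev p ! Suc i} \<in> E" if i: "Suc i < length p" for i
  proof -
    have "{p ! (length p - Suc (Suc i)), p ! Suc (length p - Suc (Suc i))} \<in> E"
      using p i by (simp add: is_walk_def)
    moreover have "Suc (length p - Suc (Suc i)) = length p - Suc i" using i by simp
    ultimately show ?thesis using i by (simp add: rev_nth insert_commute)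
  qed
  then show ?thesis using p by (simp add: is_walk_def)
qed

lemma walk_between_rev: "walk_between V E u p v \<Longrightarrow> walk_between V E v (rev p) u"
  by (auto simp: walk_between_def is_walk_rev hd_rev last_rev)

lemma is_walk_mono: "is_walk V E p \<Longrightarrow> V \<subseteq> V' \<Longrightarrow> E \<subseteq> E' \<Longrightarrow> is_walk V' E' p"
  by (auto simp: is_walk_def)

lemma walk_leaves_set:
  assumes "is_walk V E p" "hd p \<in> S" "last p \<notin> S"
  shows "\<exists>x\<in>S. \<exists>y. y \<notin> S \<and> y \<in> V \<and> {x, y} \<in> E"
  using assms
proof (induction p)
  case Nil
  then show ?case by (simp add: is_walk_def)
next
  case (Cons x p)
  show ?case
  proof (cases "p = []")
    case True
    then show ?thesis using Cons.prems by simp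
  next
    case False
    then have p: "is_walk V E p" "{x, hd p} \<in> E" using Cons.prems by (simp_all add: is_walk_Cons)
    show ?thesis
    proof (cases "hd p \<in> S")
      case True
      then show ?thesis using Cons.IH[OF p(1) True] Cons.prems False by simp
    next
      case hd: False
      have "hd p \<in> V" using p(1) False by (auto simp: is_walk_def)
      then show ?thesis using p(2) hd Cons.prems by auto
    qed
  qed
qed

text \<open>The new vertex is a leaf: the new cut isolates \<open>y\<close>, and in every old cut
  \<open>y\<close> is on the side of \<open>x\<close>.\<close>

lemma spanning_cuts_extend:
  assumes sc: "spanning_cuts S F R" and x: "x \<in> S" and y: "y \<notin> S"
  shows "spanning_cuts (insert y S) (insert {x, y} F) (R(y := insert {x, y} (R x)))"
proof -
  let ?e = "{x, y}"
  let ?S = "insert y S" and ?F = "insert ?e F" and ?R = "R(y := insert ?e (R x))"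
  interpret spanning_cuts S F R by (rule sc)
  have new: "?e \<notin> F"
  proof
    assume "?e \<in> F"
    then obtain a b where "a \<in> S" "b \<in> S" "?e = {a, b}" using ends[of ?e] by metis
    then show False using y by (auto simp: doubleton_eq_iff)
  qed
  have Rx: "?R x = R x" "?R y = insert ?e (R x)" using x y by auto
  have RS: "?R v = R v" if "v \<in> S" for v using that y by auto
  have e_notin: "?e \<notin> R v" if "v \<in> S" for v using R_subset[OF that] new by blast
  have 1: "?R v \<subseteq> ?F" if "v \<in> ?S" for v using that R_subset x by auto
  have 2: "\<exists>a b. a \<in> ?S \<and> b \<in> ?S \<and> e = {a, b} \<and> sym_diff (?R a) (?R b) = {e}" if "e \<in> ?F" for e
  proof (cases "e = ?e")
    case True
    have "sym_diff (?R x) (?R y) = {?e}" using e_notin[OF x] by (simp only: Rx) blast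
    then show ?thesis using True x by blast
  next
    case False
    then obtain a b where "a \<in> S" "b \<in> S" "e = {a, b}" "sym_diff (R a) (R b) = {e}"
      using ends \<open>e \<in> ?F\<close> by blast
    then show ?thesis using RS[of a] RS[of b] by (metis insertI2)
  qed
  have 3: "\<exists>p q. \<forall>v\<in>?S. \<not> ((g \<in> ?R v) = p \<and> (h \<in> ?R v) = q)" if gh: "g \<in> ?F" "h \<in> ?F" "g \<noteq> h" for g h
  proof -
    \<comment> \<open>The only vertex beyond the new edge is \<open>y\<close>, which agrees with
      \<open>x\<close> about \<open>h\<close>; the region with the opposite side of \<open>h\<close>
      is empty.\<close>
    have new_cut: "\<exists>q. \<forall>v\<in>?S. \<not> (?e \<in> ?R v \<and> (h \<in> ?R v) = q)" if "h \<in> F" for h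
      using that e_notin new RS by (intro exI[of _ "h \<notin> R x"]) auto
    consider "g = ?e" "h \<in> F" | "h = ?e" "g \<in> F" | "g \<in> F" "h \<in> F"
      using gh by blast
    then show ?thesis
    proof cases
      case 1
      then show ?thesis using new_cut[of h] by blast
    next
      case 2
      then show ?thesis using new_cut[of g] by blast
    next
      case 3
      then obtain p q where pq: "\<forall>v\<in>S. \<not> ((g \<in> R v) = p \<and> (h \<in> R v) = q)"
        using compatible[OF 3 \<open>g \<noteq> h\<close>] by blast
      have "\<not> ((g \<in> ?R v) = p \<and> (h \<in> ?R v) = q)" if "v \<in> ?S" for v
        using that pq x 3 new RS[of v] by (cases "v = y") auto
      then show ?thesis by blast
    qed
  qed
  have from_y: "\<exists>p. walk_between ?S ?F y p v \<and> distinct p \<and>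
      length p = Suc (card (sym_diff (?R y) (?R v)))" if v: "v \<in> ?S" for v
  proof (cases "v = y")
    case True
    then show ?thesis by (intro exI[of _ "[y]"]) (simp add: walk_between_def is_walk_def)
  next
    case False
    then have vS: "v \<in> S" using v by simp
    obtain p where p: "walk_between S F x p v" "distinct p" "length p = Suc (card (sym_diff (R x) (R v)))"
      using walks[OF x vS] by blast
    have "sym_diff (?R y) (?R v) = insert ?e (sym_diff (R x) (R v))"
      using RS[OF vS] Rx(2) e_notin[OF vS] by auto
    moreover have "?e \<notin> sym_diff (R x) (R v)" using e_notin x vS by blast
    moreover have "finite (sym_diff (R x) (R v))"
      using R_subset[OF x] R_subset[OF vS] finite_F by (meson finite_Diff finite_UnI finite_subset)
    ultimately have card: "card (sym_diff (?R y) (?R v)) = Suc (card (sym_diff (R x) (R v)))" by simp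
    have ne: "p \<noteq> []" and set_p: "set p \<subseteq> S" using p(1) by (auto simp: walk_between_def is_walk_def)
    have "is_walk ?S ?F p" using p(1) is_walk_mono[of S F p ?S ?F] by (auto simp: walk_between_def)
    then have "walk_between ?S ?F y (y # p) v"
      using p(1) ne by (auto simp: walk_between_def is_walk_Cons insert_commute)
    then show ?thesis using p card set_p y by (intro exI[of _ "y # p"]) auto
  qed
  have 4: "\<exists>p. walk_between ?S ?F u p v \<and> distinct p \<and> length p = Suc (card (sym_diff (?R u) (?R v)))"
    if uv: "u \<in> ?S" "v \<in> ?S" for u v
  proof -
    consider "u = y" | "v = y" | "u \<in> S" "v \<in> S" using uv by blast
    then show ?thesis
    proof cases
      case 1
      then show ?thesis using from_y uv by blast
    next
      case 2
      obtain p where p: "walk_between ?S ?F y p u" "distinct p" "length p = Suc (card (sym_diff (?R y) (?R u)))"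
        using from_y uv by blast
      have "sym_diff (?R u) (?R y) = sym_diff (?R y) (?R u)" by blast
      then show ?thesis using walk_between_rev[OF p(1)] p 2
        by (intro exI[of _ "rev p"]) auto
    next
      case 3
      obtain p where p: "walk_between S F u p v" "distinct p" "length p = Suc (card (sym_diff (R u) (R v)))"
        using walks 3 by blast
      have "walk_between ?S ?F u p v"
        using p(1) is_walk_mono[of S F p ?S ?F] by (auto simp: walk_between_def)
      then show ?thesis using p RS[OF 3(1)] RS[OF 3(2)] by metis
    qed
  qed
  show ?thesis
    by unfold_locales (erule (2) 3 | erule (1) 4 | erule 1 | erule 2 | simp add: finite_S finite_F card_S y new)+
qed

lemma tree_spanning_cuts:
  assumes tree: "is_tree V E"
  obtains R where "spanning_cuts V E R"
proof -
  have fs: "finite V" "\<forall>e\<in>E. e \<subseteq> V \<and> card e = 2" and ne: "V \<noteq> {}"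
    and con: "\<And>u v. u \<in> V \<Longrightarrow> v \<in> V \<Longrightarrow> \<exists>p. walk_between V E u p v"
    and acyc: "\<nexists>p. is_cycle V E p"
    using tree unfolding is_tree_def fin_simple_graph_def connected_graph_def by auto
  have grow: "\<exists>S F R. S \<subseteq> V \<and> F \<subseteq> E \<and> card S = Suc n \<and> spanning_cuts S F R" if "Suc n \<le> card V" for n
    using that
  proof (induction n)
    case 0
    obtain v where v: "v \<in> V" using ne by blast
    have "spanning_cuts {v} {} (\<lambda>_. {})"
      by unfold_locales (auto intro!: exI[of _ "[v]"] simp: walk_between_def is_walk_def)
    then show ?case using v by (intro exI[of _ "{v}"] exI[of _ "{}"]) auto
  next
    case (Suc n)
    then obtain S F R where S: "S \<subseteq> V" "F \<subseteq> E" "card S = Suc n" "spanning_cuts S F R" by auto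
    obtain s where s: "s \<in> S" using S(3) by fastforce
    have "S \<noteq> V" using S(3) Suc.prems by auto
    then obtain v where v: "v \<in> V" "v \<notin> S" using S(1) by blast
    obtain p where p: "walk_between V E s p v" using con S(1) s v by blast
    obtain x y where xy: "x \<in> S" "y \<notin> S" "y \<in> V" "{x, y} \<in> E"
      using walk_leaves_set[of V E p S] p s v by (auto simp: walk_between_def)
    have "finite S" using S(1) fs(1) finite_subset by blast
    then have "card (insert y S) = Suc (Suc n)" using xy(2) S(3) by simp
    then show ?case
      using spanning_cuts_extend[OF S(4) xy(1,2)] S xy by (meson insert_subset)
  qed
  have "card V \<noteq> 0" using fs(1) ne by simp
  then obtain S F R where S: "S \<subseteq> V" "F \<subseteq> E" "card S = card V" "spanning_cuts S F R"
    using grow[of "card V - 1"] by auto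
  have "S = V" using S(1,3) fs(1) card_subset_eq by blast
  moreover have "E \<subseteq> F"
  proof (rule ccontr)
    assume "\<not> E \<subseteq> F"
    then obtain e where e: "e \<in> E" "e \<notin> F" by blast
    obtain a b where ab: "e = {a, b}" "a \<noteq> b" using fs(2) e(1) by (metis card_2_iff)
    have "a \<in> V" "b \<in> V" using fs(2) e(1) ab by auto
    then obtain p where p: "walk_between V F a p b" "distinct p"
      using spanning_cuts.walks[OF S(4)] \<open>S = V\<close> by blast
    have ne: "p \<noteq> []" and hl: "hd p = a" "last p = b" and w: "is_walk V F p"
      using p(1) by (auto simp: walk_between_def is_walk_def)
    \<comment> \<open>A cycle needs three vertices: one is excluded by \<open>a \<noteq> b\<close>,
      two by \<open>e \<notin> F\<close>.\<close>
    have "length p \<noteq> 1" using hl ab(2) by (cases p) auto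
    moreover have "length p \<noteq> 2"
    proof
      assume "length p = 2"
      then obtain c d where "p = [c, d]" by (metis One_nat_def Suc_1 length_0_conv length_Suc_conv)
      then have "{a, b} \<in> F" using w hl by (simp add: is_walk_Cons)
      then show False using e ab by simp
    qed
    moreover have "length p \<noteq> 0" using ne by simp
    ultimately have "3 \<le> length p" by linarith
    then have "is_cycle V E p"
      using p(2) is_walk_mono[OF w subset_refl S(2)] hl e(1) ab(1)
      by (simp add: is_cycle_def insert_commute)
    then show False using acyc by blast
  qed
  ultimately have "spanning_cuts V E R" using S(2,4) by (simp add: subset_antisym)
  then show thesis using that by blast
qed

lemma card_tree_edges:
  assumes "is_tree V E"
  shows "card V = Suc (card E)"
proof -
  obtain R where "spanning_cuts V E R" using tree_spanning_cuts[OF assms] .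
  then show ?thesis by (rule spanning_cuts.card_S)
qed

section \<open>From graph distance to cuts\<close>

text \<open>The walks of the spanning tree bound \<open>graph_dist\<close> by the number of
  separating edges, so every \<open>r\<close>-matching of the graph is a matching for the
  cuts.\<close>

lemma num_r_matchings_le:
  assumes tree: "is_tree V E"
  obtains R end1 end2 where "cut_tree V E R end1 end2"
    "num_r_matchings r V E \<le> card {M. cut_tree.matching R end1 r E M}"
proof -
  obtain R where sc: "spanning_cuts V E R" using tree_spanning_cuts[OF tree] .
  interpret S: spanning_cuts V E R by (rule sc)
  define ends where "ends e = (SOME (a, b). a \<in> V \<and> b \<in> V \<and> e = {a, b} \<and> sym_diff (R a) (R b) = {e})" for e
  define end1 end2 where "end1 = fst \<circ> ends" and "end2 = snd \<circ> ends"
  have en: "end1 e \<in> V \<and> end2 e \<in> V \<and> e = {end1 e, end2 e} \<and>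
      sym_diff (R (end1 e)) (R (end2 e)) = {e}" if "e \<in> E" for e
  proof -
    have "\<exists>ab. case ab of (a, b) \<Rightarrow> a \<in> V \<and> b \<in> V \<and> e = {a, b} \<and> sym_diff (R a) (R b) = {e}"
      using S.ends[OF that] by simp
    from someI_ex[OF this] show ?thesis
      unfolding end1_def end2_def ends_def[symmetric] by (simp add: case_prod_beta)
  qed
  have "V \<noteq> {}" using tree by (auto simp: is_tree_def connected_graph_def)
  interpret cut_tree V E R end1 end2
  proof
    fix e g assume "e \<in> E" "g \<in> E"
    then have "g \<in> sym_diff (R (end1 e)) (R (end2 e)) \<longleftrightarrow> g = e" using en[of e] by simp
    then show "(g \<in> R (end1 e)) \<noteq> (g \<in> R (end2 e)) \<longleftrightarrow> g = e" by simp blast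
  qed (use S.finite_S S.finite_F \<open>V \<noteq> {}\<close> en S.compatible in simp_all)
  have dist: "graph_dist V E u v \<le> enat (card (path E u v))" if uv: "u \<in> V" "v \<in> V" for u v
  proof -
    obtain p where p: "walk_between V E u p v" "length p = Suc (card (sym_diff (R u) (R v)))"
      using S.walks[OF uv] by blast
    have "sym_diff (R u) (R v) = path E u v" using S.R_subset uv by (auto simp: path_def)
    then have "enat (length p - 1) = enat (card (path E u v))" using p(2) by simp
    then show ?thesis unfolding graph_dist_def using p(1) by (metis (mono_tags, lifting) INF_lower mem_Collect_eq)
  qed
  have "matching r E M" if M: "r_matching r V E M" for M
    unfolding matching_def
  proof (intro conjI ballI impI)
    show ME: "M \<subseteq> E" using M by (simp add: r_matching_def)
    fix e f assume ef: "e \<in> M" "f \<in> M" "e \<noteq> f"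
    then have E: "e \<in> E" "f \<in> E" using ME by auto
    \<comment> \<open>The ends \<open>v\<close> and \<open>v'\<close> that face each other are
      chosen, so that \<open>between\<close> is the whole path from \<open>v\<close> to
      \<open>v'\<close>.\<close>
    obtain v where v: "v \<in> {end1 e, end2 e}" "e \<notin> path E v (end1 f)"
      using edge_separates_ends[OF E(1,1)] by (auto simp: path_def)
    obtain v' where v': "v' \<in> {end1 f, end2 f}" "f \<notin> path E v v'"
      using edge_separates_ends[OF E(2,2)] by (auto simp: path_def)
    have "e \<notin> path E v v'"
      using v v' edge_separates_ends[OF E(2,1)] ef(3) by (auto simp: path_def)
    then have eq: "between E e f = path E v v'"
      using between_other_ends[OF subset_refl E v(1) v'(1)] v'(2) by auto
    have V: "v \<in> V" "v' \<in> V" "v \<in> e" "v' \<in> f" using v v' en E by blast+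
    have "enat r \<le> edge_dist V E e f" using M ef by (simp add: r_matching_def)
    also have "\<dots> \<le> graph_dist V E v v'"
      unfolding edge_dist_def using V INF_lower[of "(v, v')" "e \<times> f" "\<lambda>(v, v'). graph_dist V E v v'"] by simp
    also have "\<dots> \<le> enat (card (path E v v'))" using dist V by simp
    finally show "r \<le> card (between E e f)" using eq by simp
  qed
  then have "num_r_matchings r V E \<le> card {M. matching r E M}"
    unfolding num_r_matchings_def using finite_matchings[OF S.finite_F] by (intro card_mono) auto
  then show thesis using that cut_tree_axioms by blast
qed

subsection \<open>The inequality for the growth rate\<close>

lemma exp_1_ge: "2.7 \<le> exp (1::real)"
proof -
  have "(1 + 1/8 + (1/8)\<^sup>2 / 2) ^ 8 \<le> exp (1/8 :: real) ^ 8"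
    by (intro power_mono exp_lower_Taylor_quadratic) auto
  also have "exp (1/8 :: real) ^ 8 = exp 1" by (simp flip: exp_of_nat_mult)
  finally show ?thesis by (simp add: power_numeral_reduce power2_eq_square)
qed

lemma exp_1_le: "exp (1::real) \<le> 2.77"
proof -
  have "exp (1/32 :: real) ^ 32 \<le> (1 + 1/32 + (1/32)\<^sup>2) ^ 32"
    by (intro power_mono exp_bound) auto
  also have "exp (1/32 :: real) ^ 32 = exp 1" by (simp flip: exp_of_nat_mult)
  finally show ?thesis by (simp add: power_numeral_reduce power2_eq_square)
qed

lemma exp_31_ge: "21 \<le> exp (3.1::real)"
proof -
  have "2.7 ^ 3 * (1 + 0.1 + 0.1\<^sup>2 / 2) \<le> exp (1::real) ^ 3 * exp 0.1"
    by (intro mult_mono power_mono exp_lower_Taylor_quadratic exp_1_ge) auto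
  also have "exp (1::real) ^ 3 * exp 0.1 = exp 3.1" by (simp flip: exp_of_nat_mult exp_add)
  finally show ?thesis by (simp add: power2_eq_square power3_eq_cube)
qed

section \<open>The growth rate and its logarithm\<close>

text \<open>Here \<open>t\<close> is \<open>s + 1\<close>, \<open>r_eq\<close> is the equation
  defining \<open>s\<close>, and \<open>exp a\<close> is the base of the claimed bound.\<close>

locale growth_rate =
  fixes r :: nat and t a :: real
  assumes r: "2 \<le> r" and t: "1 < t" and r_eq: "real r / 2 = t * ln t - t + 1"
    and a: "a = 1 / t + 1 / real r"
begin

lemma t_ge: "2.7 \<le> t"
proof -
  have "0 \<le> t * (ln t - 1)" using r r_eq by (simp add: algebra_simps)
  then have "1 \<le> ln t" using t by (simp add: zero_le_mult_iff)
  then have "exp 1 \<le> t" using t by (simp add: ln_ge_iff)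
  then show ?thesis using exp_1_ge by linarith
qed

lemma r_pos: "0 < real r" using r by simp

lemma a_pos: "0 < a" unfolding a using t r_pos by (intro add_pos_pos) auto

lemma ta_ge: "1 \<le> t * a" using t r_pos by (simp add: a field_simps)

lemma a_le_1: "a \<le> 1"
proof -
  have "1 / t \<le> 1 / 2" using t_ge by (intro divide_left_mono) auto
  moreover have "1 / real r \<le> 1 / 2" using r by (intro divide_left_mono) auto
  ultimately show ?thesis by (simp add: a)
qed

text \<open>Since \<open>1 / a = t * r / (t + r)\<close>, the hypothesis is the claim with
  denominators cleared.\<close>

lemma inverse_a_le:
  assumes "g * real r \<le> t * (t - g)"
  shows "1 / a \<le> t - g"
proof -
  have "a * (t - g) = 1 + (t * (t - g) - g * real r) / (t * real r)"
    using t r_pos by (simp add: a field_simps)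
  also have "\<dots> \<ge> 1" using assms t r_pos by simp
  finally show ?thesis using a_pos by (simp add: field_simps)
qed

text \<open>The tangent of the logarithm at \<open>p\<close>, with \<open>ln p\<close> replaced by
  its upper bound \<open>q\<close>.\<close>

lemma ln_le_tangent: "0 < p \<Longrightarrow> exp q \<ge> p \<Longrightarrow> ln t \<le> t / p + q - 1"
proof -
  assume p: "0 < p" "exp q \<ge> p"
  have "ln (t / p) \<le> t / p - 1" using p t by (intro ln_le_minus_one) simp
  moreover have "ln (t / p) = ln t - ln p" using p t by (simp add: ln_div)
  moreover have "ln p \<le> q" using p by (metis ln_exp ln_le_cancel_iff exp_gt_zero)
  ultimately show ?thesis by linarith
qed

lemma inverse_a_le_minus_1: "1 / a \<le> t - 1"
proof (rule inverse_a_le)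
  have "ln t \<le> t / 2.7 + 1 - 1" using exp_1_ge by (intro ln_le_tangent) auto
  then have "t * ln t \<le> t * (t / 2.7)" using t by (intro mult_left_mono) auto
  also have "\<dots> = t\<^sup>2 * (10 / 27)" by (simp add: power2_eq_square)
  finally have "t * ln t \<le> t\<^sup>2 * (10 / 27)" .
  moreover have "2 * t \<le> t\<^sup>2" unfolding power2_eq_square using t_ge by (intro mult_right_mono) auto
  ultimately have "real r \<le> t\<^sup>2 - t" using r_eq t_ge by linarith
  then show "1 * real r \<le> t * (t - 1)" by (simp add: algebra_simps power2_eq_square)
qed

text \<open>By \<open>r_eq\<close>, \<open>a * (r / 2) = ln t + 1 / t - 1 / 2\<close>; this trades
  \<open>r\<close> for \<open>t\<close>.\<close>

lemma exp_half: "exp (a * (real r / 2)) = t * exp (1 / t - 1 / 2)"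
proof -
  have "a * (real r / 2) = (real r / 2) / t + 1 / 2" using r_pos by (simp add: a field_simps)
  also have "\<dots> = ln t + (1 / t - 1 / 2)" unfolding r_eq using t by (simp add: field_simps)
  finally have *: "a * (real r / 2) = ln t + (1 / t - 1 / 2)" .
  show ?thesis unfolding * exp_add using t by simp
qed

lemma exp_half_ge: "(t + 1) * exp (x - 1 / 2) \<le> exp (a * (real r / 2) + x)"
proof -
  have "t + 1 \<le> t * exp (1 / t)"
    using mult_left_mono[OF exp_ge_add_one_self[of "1 / t"], of t] t by (simp add: distrib_left)
  then have "(t + 1) * exp (x - 1 / 2) \<le> t * exp (1 / t) * exp (x - 1 / 2)"
    by (intro mult_right_mono) auto
  also have "\<dots> = exp (a * (real r / 2) + x)"
    unfolding exp_add exp_half by (simp add: exp_diff)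
  finally show ?thesis .
qed

text \<open>The limit of the geometric series \<open>exp (- 2 * a) + exp (- 4 * a) + \<dots>\<close>; it is slightly below \<open>t / 2\<close>.\<close>

definition c :: real where "c = 1 / (exp (2 * a) - 1)"

text \<open>A weak form of the expansion \<open>1 / (2 * a) - 1 / 2 + a / 6 - ...\<close>, which
  follows from the quadratic Taylor bound.\<close>

lemma c_le: "c \<le> 1 / (2 * a) - 1 / 2 + a / 2"
proof -
  have pos: "0 < 2 * a * (1 + a)" using a_pos by simp
  have "2 * a * (1 + a) \<le> exp (2 * a) - 1"
    using exp_lower_Taylor_quadratic[of "2 * a"] a_pos by (simp add: power2_eq_square algebra_simps)
  then have "c \<le> 1 / (2 * a * (1 + a))"
    unfolding c_def using pos a_pos by (intro divide_left_mono mult_pos_pos) auto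
  also have "\<dots> \<le> 1 / (2 * a) - 1 / 2 + a / 2"
  proof -
    define z where "z = 1 / (1 + a)"
    have "1 - a \<le> z"
      unfolding z_def using a_pos by (subst pos_le_divide_eq) (auto simp: algebra_simps)
    moreover have "1 / (2 * a * (1 + a)) = 1 / (2 * a) - z / 2"
      unfolding z_def using a_pos by (simp add: divide_simps)
    ultimately show ?thesis by simp
  qed
  finally show ?thesis .
qed

lemma c_ge: "1 \<le> a * (2 + 2 * c)"
proof -
  have e: "1 < exp (2 * a)" using a_pos by simp
  have "exp (2 * a) * (1 - 2 * a) \<le> exp (2 * a) * exp (- (2 * a))"
    using exp_ge_add_one_self[of "- (2 * a)"] by (intro mult_left_mono) auto
  also have "\<dots> = 1" by (simp flip: exp_add)
  finally have "exp (2 * a) - 1 \<le> 2 * a * exp (2 * a)" by (simp add: algebra_simps)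
  moreover have "a * (2 + 2 * c) = 2 * a * exp (2 * a) / (exp (2 * a) - 1)"
    using e by (simp add: c_def field_simps)
  ultimately show ?thesis using e by simp
qed

lemma c_pos: "0 < c" using a_pos by (simp add: c_def)

section \<open>Bounds for short and long trunks\<close>

text \<open>The tangent bound \<open>1 / 2 + x \<le> exp (x - 1 / 2)\<close> makes the right side
  linear in \<open>Y\<close> with slope at least 1, so it suffices to compare at
  \<open>Y = 1\<close>.\<close>

lemma short_trunk_bound:
  assumes "1 \<le> Y"
  shows "1 + Y + c \<le> exp (a * (real r / 2 - 1 / 2 + Y))"
proof -
  have "(t + 1) * (1 / 2 + a * (Y - 1 / 2)) \<le> (t + 1) * exp (a * (Y - 1 / 2) - 1 / 2)"
    using exp_ge_add_one_self[of "a * (Y - 1 / 2) - 1 / 2"] t by (intro mult_left_mono) auto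
  also have "\<dots> \<le> exp (a * (real r / 2) + a * (Y - 1 / 2))" by (rule exp_half_ge)
  also have "a * (real r / 2) + a * (Y - 1 / 2) = a * (real r / 2 - 1 / 2 + Y)"
    by (simp add: algebra_simps)
  finally have 1: "(t + 1) * (1 / 2 + a * (Y - 1 / 2)) \<le> exp (a * (real r / 2 - 1 / 2 + Y))" .
  have "1 * (Y - 1) \<le> (t * a + a) * (Y - 1)" using ta_ge a_pos assms by (intro mult_right_mono) auto
  moreover have "(t + 1) * (1 / 2 + a * (Y - 1 / 2)) = (t + 1 + t * a + a) / 2 + (t * a + a) * (Y - 1)"
    by (simp add: field_simps)
  moreover have "1 / (2 * a) \<le> (t - 1) / 2" using inverse_a_le_minus_1 by (simp add: field_simps)
  ultimately show ?thesis using 1 c_le ta_ge by (simp add: field_simps)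
qed

text \<open>
  For \<open>t\<close> up to about 30, \<open>exp (- (2 * a * A))\<close> may be bounded by 1; for larger \<open>t\<close> it is small unless
  \<open>a * j\<close> is large. The threshold 21 leaves room in both arguments.
\<close>

lemma long_trunk_bound_small:
  assumes "t \<le> 21" "0 \<le> j"
  shows "2 + 2 * j \<le> exp (a * (real r / 2 + 1 / 2 + j))"
proof -
  have "ln t \<le> ln (exp 3.1)" using t assms(1) exp_31_ge by (subst ln_le_cancel_iff) auto
  then have "ln t \<le> 3.1" by simp
  then have "t * ln t \<le> t * 3.1" using t by (intro mult_left_mono) auto
  then have r_le: "real r \<le> 4.2 * t + 2" using r_eq by simp
  \<comment> \<open>A lower bound for \<open>a\<close> in terms of \<open>t\<close> alone;
    \<open>x * (1 - x / 2)\<close> increases on the unit interval, so \<open>p\<close> may replace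
    \<open>a\<close> there.\<close>
  define p where "p = 1 / t + 1 / (4.2 * t + 2)"
  have "1 / (4.2 * t + 2) \<le> 1 / real r" using r_le r_pos t by (intro divide_left_mono) auto
  then have pa: "p \<le> a" by (simp add: p_def a)
  have "0 \<le> (a - p) * (1 - (a + p) / 2)" using pa a_le_1 by (intro mult_nonneg_nonneg) auto
  then have ap: "p * (1 - p / 2) \<le> a * (1 - a / 2)" by (simp add: field_simps)
  \<comment> \<open>The factor \<open>13 / 8\<close> is a lower bound for
    \<open>exp (1 / 2)\<close>, and \<open>1 - a / 2\<close> one for
    \<open>exp (- a / 2)\<close>.\<close>
  have poly: "16 \<le> 13 * ((t + 1) * (p * (1 - p / 2)))"
  proof -
    have p_eq: "p = (5.2 * t + 2) / (t * (4.2 * t + 2))"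
    proof -
      have "p = ((4.2 * t + 2) + t) / (t * (4.2 * t + 2))"
        unfolding p_def using t by (subst add_frac_eq) auto
      then show ?thesis by simp
    qed
    \<comment> \<open>This quartic is the difference of the two sides of the next inequality,
      multiplied out.\<close>
    have "0 \<le> 84 / 25 * t ^ 4 + 4188 / 25 * t ^ 3 - 3928 / 25 * t\<^sup>2 - 1092 / 5 * t - 52"
    proof -
      have "2 * t \<le> t\<^sup>2" unfolding power2_eq_square using t_ge by (intro mult_right_mono) auto
      moreover have "2 * t\<^sup>2 \<le> t ^ 3"
        unfolding power3_eq_cube power2_eq_square mult.assoc using t_ge by (intro mult_right_mono) auto
      moreover have "0 \<le> t ^ 4" by simp
      ultimately show ?thesis using t_ge by linarith
    qed
    then have "32 * (t\<^sup>2 * (4.2 * t + 2)\<^sup>2) \<le> 13 * ((t + 1) * ((5.2 * t + 2) * (2 * (t * (4.2 * t + 2)) - (5.2 * t + 2))))"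
      by (simp add: field_simps power2_eq_square power3_eq_cube power4_eq_xxxx)
    moreover have "p * (1 - p / 2) = (5.2 * t + 2) * (2 * (t * (4.2 * t + 2)) - (5.2 * t + 2)) / (2 * (t\<^sup>2 * (4.2 * t + 2)\<^sup>2))"
    proof -
      have "x / D * (1 - (x / D) / 2) = x * (2 * D - x) / (2 * D\<^sup>2)" if "D \<noteq> 0" for x D :: real
        using that by (simp add: field_simps power2_eq_square)
      from this[of "t * (4.2 * t + 2)" "5.2 * t + 2"] show ?thesis
        using t unfolding p_eq by (simp add: power_mult_distrib)
    qed
    moreover have "0 < t\<^sup>2 * (4.2 * t + 2)\<^sup>2" using t by simp
    ultimately show ?thesis by (simp add: field_simps)
  qed
  have "2 * (j + 1) \<le> 13 / 8 * ((t + 1) * (p * (1 - p / 2))) * (j + 1)"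
    using poly assms(2) by (intro mult_right_mono) auto
  also have "\<dots> \<le> 13 / 8 * ((t + 1) * (a * (1 - a / 2))) * (j + 1)"
    using ap t assms(2) by (intro mult_right_mono mult_left_mono) auto
  also have "\<dots> = (t + 1) * (13 / 8 * (1 - a / 2) * (a * (j + 1)))" by (simp only: mult_ac)
  also have "\<dots> \<le> (t + 1) * (exp (1 / 2) * exp (- a / 2) * exp (a * (j + 1) - 1))"
  proof -
    have "13 / 8 \<le> exp (1 / 2 :: real)"
      using exp_lower_Taylor_quadratic[of "1 / 2"] by (simp add: power2_eq_square)
    moreover have "1 - a / 2 \<le> exp (- a / 2)" using exp_ge_add_one_self[of "- a / 2"] by simp
    moreover have "a * (j + 1) \<le> exp (a * (j + 1) - 1)"
      using exp_ge_add_one_self[of "a * (j + 1) - 1"] by simp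
    ultimately show ?thesis using t a_pos a_le_1 assms(2) by (intro mult_left_mono mult_mono) auto
  qed
  also have "exp (1 / 2) * exp (- a / 2) * exp (a * (j + 1) - 1) = exp (a * (1 / 2 + j) - 1 / 2)"
    by (simp flip: exp_add add: algebra_simps)
  also have "(t + 1) * exp (a * (1 / 2 + j) - 1 / 2) \<le> exp (a * (real r / 2) + a * (1 / 2 + j))"
    by (rule exp_half_ge)
  finally show ?thesis by (simp add: algebra_simps)
qed

text \<open>The tangent of the logarithm at 20 bounds \<open>r\<close> by a small multiple of the
  square of \<open>t\<close>.\<close>

lemma inverse_a_le_large:
  assumes "21 \<le> t"
  shows "1 / a \<le> t - 3"
proof (rule inverse_a_le)
  have "ln t \<le> t / 20 + 3.1 - 1" using exp_31_ge by (intro ln_le_tangent) auto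
  then have "t * ln t \<le> t * (t / 20 + 2.1)" using t by (intro mult_left_mono) auto
  also have "\<dots> = t\<^sup>2 / 20 + 2.1 * t" by (simp add: power2_eq_square algebra_simps)
  finally have "t * ln t \<le> t\<^sup>2 / 20 + 2.1 * t" .
  moreover have "21 * t \<le> t\<^sup>2" unfolding power2_eq_square using assms by (intro mult_right_mono) auto
  ultimately have "3 * real r \<le> t\<^sup>2 - 3 * t" using r_eq assms by linarith
  then show "3 * real r \<le> t * (t - 3)" by (simp add: algebra_simps power2_eq_square)
qed

lemma long_trunk_bound_large:
  assumes "21 \<le> t" "c \<le> j" "real r / 2 - j \<le> real A"
  shows "2 + j + c + exp (- (2 * a * real A)) * (j - c) \<le> exp (a * (real r / 2 + 1 / 2 + j))"
proof -
  define v where "v = a * j"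
  define q where "q = exp (- (2 * a * real A))"
  have q: "0 < q" "q \<le> 1" using a_pos by (auto simp: q_def)
  have j: "j = 1 / a * v" using a_pos by (simp add: v_def)
  have v0: "0 \<le> v" using assms(2) c_pos a_pos by (simp add: v_def)
  have inv: "1 / a \<le> t - 3" by (rule inverse_a_le_large[OF assms(1)])
  have low: "(t + 1) * exp (v + a / 2 - 1 / 2) \<le> exp (a * (real r / 2 + 1 / 2 + j))"
    using exp_half_ge[of "v + a / 2"] by (simp add: v_def algebra_simps)
  show ?thesis
  proof (cases "2 \<le> v")
    case True
    \<comment> \<open>Squaring the quadratic Taylor bound at half the argument gives degree four;
      the quadratic bound at \<open>v - 1 / 2\<close> itself is too weak near
      \<open>v = 2\<close>.\<close>
    define x where "x = (v - 1 / 2) / 2"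
    have x: "3 / 4 \<le> x" "2 * v = 4 * x + 1" using True by (simp_all add: x_def field_simps)
    have "2 * v \<le> (1 + x + x\<^sup>2 / 2)\<^sup>2"
    proof -
      have "3 / 4 * x \<le> x\<^sup>2" unfolding power2_eq_square using x by (intro mult_right_mono) auto
      moreover have "3 / 4 * x\<^sup>2 \<le> x ^ 3"
        unfolding power3_eq_cube power2_eq_square mult.assoc using x by (intro mult_right_mono) auto
      moreover have "0 \<le> x ^ 4" by simp
      moreover have "(1 + x + x\<^sup>2 / 2)\<^sup>2 = 1 + 2 * x + 2 * x\<^sup>2 + x ^ 3 + x ^ 4 / 4"
        by (simp add: power2_eq_square power3_eq_cube power4_eq_xxxx field_simps)
      ultimately show ?thesis using x by linarith
    qed
    also have "\<dots> \<le> (exp x)\<^sup>2"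
      using x by (intro power_mono exp_lower_Taylor_quadratic) auto
    also have "\<dots> = exp (v - 1 / 2)" by (simp add: x_def flip: exp_double)
    also have "\<dots> \<le> exp (v + a / 2 - 1 / 2)" using a_pos by simp
    finally have e: "2 * v \<le> exp (v + a / 2 - 1 / 2)" .
    have "q * (j - c) \<le> 1 * (j - c)" using q assms(2) by (intro mult_right_mono) auto
    then have "2 + j + c + q * (j - c) \<le> 2 + 2 * j" by simp
    also have "\<dots> \<le> 2 + 2 * ((t - 3) * v)"
      unfolding j using inv v0 by (intro add_left_mono mult_left_mono mult_right_mono) auto
    also have "\<dots> \<le> (t + 1) * (2 * v)" using True by (simp add: algebra_simps)
    also have "\<dots> \<le> (t + 1) * exp (v + a / 2 - 1 / 2)" using e t by (intro mult_left_mono) auto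
    finally show ?thesis using low by (simp add: q_def)
  next
    case False
    \<comment> \<open>The exponent \<open>2 * a * A\<close> is at least \<open>a * r - 2 * v\<close>
      with \<open>v < 2\<close>, and \<open>exp_half\<close> evaluates \<open>exp (a * r)\<close>;
      the number 164 bounds \<open>exp 5\<close>.\<close>
    have q_le: "q \<le> 164 / t\<^sup>2"
    proof -
      have "real r / 2 * (2 * a) - 2 * v \<le> 2 * a * real A"
        using mult_left_mono[OF assms(3), of "2 * a"] a_pos by (simp add: v_def algebra_simps)
      then have "q \<le> exp (4 - 2 * (a * (real r / 2)))"
        using False by (simp add: q_def algebra_simps)
      also have "\<dots> = exp 4 / (exp (a * (real r / 2)))\<^sup>2"
        by (simp add: exp_diff flip: exp_double)
      also have "\<dots> \<le> exp 4 / (t\<^sup>2 * exp (- 1))"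
      proof -
        have "exp (- 1 :: real) = (exp (- 1 / 2))\<^sup>2" by (simp flip: exp_double)
        also have "\<dots> \<le> (exp (1 / t - 1 / 2))\<^sup>2" using t by (intro power_mono) auto
        finally have "t\<^sup>2 * exp (- 1) \<le> (exp (a * (real r / 2)))\<^sup>2"
          unfolding exp_half power_mult_distrib by (intro mult_left_mono) auto
        then show ?thesis using t by (intro divide_left_mono) auto
      qed
      also have "\<dots> = exp 5 / t\<^sup>2" by (simp add: exp_minus field_simps flip: exp_add)
      also have "exp 5 = exp (1::real) ^ 5" by (simp flip: exp_of_nat_mult)
      also have "exp (1::real) ^ 5 / t\<^sup>2 \<le> 164 / t\<^sup>2"
      proof (rule divide_right_mono)
        have "exp (1::real) ^ 5 \<le> 2.77 ^ 5"
          using exp_1_le by (intro power_mono) auto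
        then show "exp (1::real) ^ 5 \<le> 164" by (simp add: power_numeral_reduce)
      qed simp
      finally show ?thesis .
    qed
    have tq: "t * q\<^sup>2 \<le> 3"
    proof -
      have "t * q\<^sup>2 \<le> t * (164 / t\<^sup>2)\<^sup>2" using q q_le t by (intro mult_left_mono power_mono) auto
      also have "\<dots> = 26896 / t ^ 3" using t by (simp add: field_simps power2_eq_square power3_eq_cube)
      also have "\<dots> \<le> 26896 / 21 ^ 3"
        using assms(1) by (intro divide_left_mono power_mono) auto
      finally show ?thesis by simp
    qed
    \<comment> \<open>Recentring at the tangency point \<open>v = 1 / 2\<close> turns the exponent
      in \<open>low\<close> into \<open>w + a / 2\<close>.\<close>
    define w where "w = v - 1 / 2"
    have a_le: "a \<le> 1 / 10"
    proof -
      have "ln (exp 2) \<le> ln t"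
      proof -
        have "exp (2::real) = (exp 1)\<^sup>2" by (simp flip: exp_double)
        also have "\<dots> \<le> 3\<^sup>2" using exp_le by (intro power_mono) auto
        finally show ?thesis using assms(1) by (subst ln_le_cancel_iff) auto
      qed
      then have "t * 2 \<le> t * ln t" using t by (intro mult_left_mono) auto
      then have "t \<le> real r" using r_eq t by linarith
      then have "1 / real r \<le> 1 / t" using t by (intro divide_left_mono) auto
      moreover have "1 / t \<le> 1 / 21" using assms(1) by (intro divide_left_mono) auto
      ultimately show ?thesis by (simp add: a)
    qed
    have rhs: "2 + j + c + q * (j - c) \<le> 2 + 1 / a * (1 + w + q * w) - (1 - q) * ((1 - a) / 2)"
    proof -
      have "(1 - q) * c \<le> (1 - q) * (1 / (2 * a) - 1 / 2 + a / 2)"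
        using c_le q by (intro mult_left_mono) auto
      moreover have "(1 - q) * (1 / (2 * a) - 1 / 2 + a / 2) = 1 / a * ((1 - q) / 2) - (1 - q) * ((1 - a) / 2)"
        using a_pos by (simp add: field_simps)
      moreover have "1 / a * (1 + w + q * w) = j + q * j + 1 / a * ((1 - q) / 2)"
        unfolding j using a_pos by (simp add: w_def field_simps)
      moreover have "2 + j + c + q * (j - c) = 2 + j + q * j + (1 - q) * c"
        by (simp add: algebra_simps)
      ultimately show ?thesis by linarith
    qed
    have drop: "0 \<le> (1 - q) * ((1 - a) / 2)" using q a_le by simp
    have low': "(t + 1) * exp (w + a / 2) \<le> exp (a * (real r / 2 + 1 / 2 + j))"
      using low by (simp add: w_def algebra_simps)
    have taa: "1 / 2 \<le> (t + 1) * (a / 2)" using ta_ge a_pos by (simp add: algebra_simps)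
    have "2 + 1 / a * (1 + w + q * w) \<le> (t + 1) * exp (w + a / 2)"
    proof (cases "0 \<le> w")
      case True
      have "0 \<le> w * (a / 2)" "0 \<le> (a / 2)\<^sup>2" using True a_pos by auto
      then have "1 + w + w\<^sup>2 / 2 + a / 2 \<le> 1 + (w + a / 2) + (w + a / 2)\<^sup>2 / 2"
        by (simp add: power2_eq_square algebra_simps)
      also have "\<dots> \<le> exp (w + a / 2)"
        using True a_pos by (intro exp_lower_Taylor_quadratic) auto
      finally have "(t + 1) * (1 + w + w\<^sup>2 / 2 + a / 2) \<le> (t + 1) * exp (w + a / 2)"
        using t by (intro mult_left_mono) auto
      moreover have "1 / a * (1 + w + q * w) \<le> (t - 3) * (1 + w + q * w)"
        using inv True q by (intro mult_right_mono) auto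
      \<comment> \<open>The square absorbs the mixed term \<open>t * (q * w)\<close> into
        \<open>t * w\<^sup>2 / 2\<close>, up to \<open>t * q\<^sup>2 / 2\<close>, which
        \<open>tq\<close> bounds.\<close>
      moreover have "0 \<le> t * (w - q)\<^sup>2" "0 \<le> q * w" "0 \<le> w\<^sup>2" using t q True by auto
      moreover have "(t + 1) * (1 + w + w\<^sup>2 / 2 + a / 2) =
          t + 1 + t * w + w + t * w\<^sup>2 / 2 + w\<^sup>2 / 2 + (t + 1) * (a / 2)"
        by (simp add: field_simps)
      moreover have "(t - 3) * (1 + w + q * w) = t + t * w + t * (q * w) - 3 - 3 * w - 3 * (q * w)"
        by (simp add: algebra_simps)
      moreover have "t * (w - q)\<^sup>2 = t * w\<^sup>2 - 2 * (t * (q * w)) + t * q\<^sup>2"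
        by (simp add: power2_eq_square algebra_simps)
      ultimately show ?thesis using tq taa True by linarith
    next
      case False
      \<comment> \<open>Since \<open>j \<ge> c\<close> and \<open>a * c \<ge> 1 / 2 - a\<close>,
        \<open>w\<close> is only slightly negative, and a linear bound for the exponential
        suffices.\<close>
      have "w \<ge> - a"
      proof -
        have "1 \<le> 2 * a + 2 * (a * c)" using c_ge by (simp add: algebra_simps)
        moreover have "a * c \<le> v" using assms(2) a_pos by (simp add: v_def)
        ultimately show ?thesis by (simp add: w_def)
      qed
      have "(t + 1) * (1 + (w + a / 2)) \<le> (t + 1) * exp (w + a / 2)"
        using t exp_ge_add_one_self by (intro mult_left_mono) auto
      moreover have "1 / a * (1 + w + q * w) \<le> 1 / a * (1 + w)"
        using False q a_pos by (intro mult_left_mono) (auto simp: mult_nonneg_nonpos)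
      moreover have "1 / a * (1 + w) \<le> (t - 3) * (1 + w)"
        using inv \<open>w \<ge> - a\<close> a_le by (intro mult_right_mono) auto
      moreover have "(t + 1) * (1 + (w + a / 2)) = t + 1 + t * w + w + (t + 1) * (a / 2)"
        by (simp add: algebra_simps)
      moreover have "(t - 3) * (1 + w) = t + t * w - 3 - 3 * w"
        by (simp add: algebra_simps)
      ultimately show ?thesis using taa \<open>w \<ge> - a\<close> a_le by linarith
    qed
    then show ?thesis using rhs drop low' by (simp add: q_def)
  qed
qed

text \<open>At \<open>Y = j + 1\<close> the left side is \<open>Q\<close>, bounded by the two
  previous estimates. Beyond that the right side grows at relative rate \<open>a\<close>, and
  \<open>a * Q \<ge> 1\<close> by \<open>c_ge\<close>, so it outgrows the left side.\<close>

lemma long_trunk_bound: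
  assumes "c \<le> j" "real r / 2 - j \<le> real A" "j + 1 \<le> Y"
  shows "1 + Y + c + exp (- (2 * a * real A)) * (j - c) \<le> exp (a * (real r / 2 - 1 / 2 + Y))"
proof -
  define Q where "Q = 2 + j + c + exp (- (2 * a * real A)) * (j - c)"
  have "Q \<le> exp (a * (real r / 2 + 1 / 2 + j))"
  proof (cases "t \<le> 21")
    case True
    have "exp (- (2 * a * real A)) * (j - c) \<le> 1 * (j - c)"
      using a_pos assms(1) by (intro mult_right_mono) auto
    then show ?thesis
      unfolding Q_def using long_trunk_bound_small[OF True, of j] assms(1) c_pos by simp
  next
    case False
    then show ?thesis unfolding Q_def using long_trunk_bound_large assms by simp
  qed
  moreover have "1 + a * (Y - j - 1) \<le> exp (a * (Y - j - 1))" using exp_ge_add_one_self by simp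
  ultimately have "Q * (1 + a * (Y - j - 1)) \<le> exp (a * (real r / 2 + 1 / 2 + j)) * exp (a * (Y - j - 1))"
    using a_pos assms(3) by (intro mult_mono) auto
  also have "\<dots> = exp (a * (real r / 2 - 1 / 2 + Y))" by (simp flip: exp_add add: algebra_simps)
  finally have 1: "Q * (1 + a * (Y - j - 1)) \<le> exp (a * (real r / 2 - 1 / 2 + Y))" .
  have "2 + 2 * c \<le> Q" unfolding Q_def using assms(1) by (simp add: add_increasing2)
  then have "1 \<le> a * Q" using c_ge mult_left_mono[of "2 + 2 * c" Q a] a_pos by linarith
  then have "1 * (Y - j - 1) \<le> a * Q * (Y - j - 1)" using assms(3) by (intro mult_right_mono) auto
  then show ?thesis using 1 by (simp add: Q_def algebra_simps)
qed

lemma geometric_sum_c: "(\<Sum>b<n. exp (- a) ^ (2 * Suc b)) = c * (1 - exp (- a) ^ (2 * n))"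
proof -
  define q where "q = exp (- a) ^ 2"
  have qe: "q = exp (- (2 * a))" by (simp add: q_def flip: exp_double)
  have "1 < exp (2 * a)" using a_pos by simp
  then have q: "q < 1" "c = q / (1 - q)"
    using a_pos unfolding qe by (simp, simp add: c_def exp_minus field_simps)
  have "(\<Sum>b<n. exp (- a) ^ (2 * Suc b)) = q * (\<Sum>b<n. q ^ b)"
    unfolding q_def power_mult by (simp add: sum_distrib_left)
  also have "\<dots> = c * (1 - q ^ n)" using q by (simp add: sum_gp_strict)
  finally show ?thesis by (simp add: q_def power_mult)
qed

text \<open>Terms with \<open>i \<ge> h\<close> equal 1 and are collected with \<open>y\<close> in
  \<open>Y\<close>. The others, in reverse order, are geometric up to index \<open>A\<close> and
  constant afterwards; their sum is at most \<open>c\<close> unless the constant stretch is longer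
  than \<open>c\<close>.\<close>

theorem cell_inequality:
  assumes k: "r + 1 \<le> 2 * k" "k \<le> r + 1"
  shows "1 + real y + (\<Sum>i<k. (1 / exp a) ^ (2 * min (r div 2 - i) (r + 1 - k))) \<le> exp a ^ (k + y)"
proof -
  define h A where "h = r div 2" and "A = r + 1 - k"
  define q where "q = exp (- a)"
  define Y where "Y = real (k - h) + real y"
  \<comment> \<open>With this shift \<open>A + j = r - h\<close>, so \<open>j\<close> bounds the
    length \<open>h - A\<close> of the constant stretch.\<close>
  define j where "j = real k - real h - 1"
  have hk: "h < k" "h \<le> k" "2 * h \<le> r" "r \<le> 2 * h + 1" using k by (auto simp: h_def)
  have Aj: "real A = real r - real h - j" using k hk by (simp add: A_def j_def of_nat_diff)
  have q: "0 < q" "q \<le> 1" "1 / exp a = q" using a_pos by (auto simp: q_def exp_minus field_simps)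
  have qA: "q ^ (2 * A) = exp (- (2 * a * real A))"
    unfolding q_def by (simp flip: exp_of_nat_mult add: algebra_simps)
  have split: "(\<Sum>i<k. q ^ (2 * min (h - i) A)) = (\<Sum>b<h. q ^ (2 * min (Suc b) A)) + real (k - h)"
  proof -
    have "(\<Sum>i<k. q ^ (2 * min (h - i) A)) = (\<Sum>i<h. q ^ (2 * min (h - i) A)) + (\<Sum>i=h..<k. q ^ (2 * min (h - i) A))"
      using hk(2) sum.atLeastLessThan_concat[of 0 h k "\<lambda>i. q ^ (2 * min (h - i) A)"] by (simp add: atLeast0LessThan)
    also have "(\<Sum>i=h..<k. q ^ (2 * min (h - i) A)) = (\<Sum>i=h..<k. 1)" by (rule sum.cong) auto
    also have "(\<Sum>i<h. q ^ (2 * min (h - i) A)) = (\<Sum>b<h. q ^ (2 * min (h - (h - Suc b)) A))"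
      by (rule sum.nat_diff_reindex[symmetric])
    also have "\<dots> = (\<Sum>b<h. q ^ (2 * min (Suc b) A))"
      by (rule sum.cong) (auto simp: Suc_leI)
    finally show ?thesis by simp
  qed
  have S: "(\<Sum>b<h. q ^ (2 * min (Suc b) A)) \<le> c \<or>
      (c \<le> j \<and> (\<Sum>b<h. q ^ (2 * min (Suc b) A)) \<le> c + q ^ (2 * A) * (j - c))"
  proof (cases "h \<le> A")
    case True
    then have "(\<Sum>b<h. q ^ (2 * min (Suc b) A)) = (\<Sum>b<h. q ^ (2 * Suc b))"
      by (intro sum.cong) auto
    also have "\<dots> \<le> c" unfolding q_def geometric_sum_c using c_pos by (simp add: mult_le_cancel_left1)
    finally show ?thesis ..
  next
    case False
    have "(\<Sum>b<h. q ^ (2 * min (Suc b) A)) = (\<Sum>b<A. q ^ (2 * min (Suc b) A)) + (\<Sum>b=A..<h. q ^ (2 * min (Suc b) A))"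
      using False sum.atLeastLessThan_concat[of 0 A h "\<lambda>b. q ^ (2 * min (Suc b) A)"] by (simp add: atLeast0LessThan)
    also have "(\<Sum>b<A. q ^ (2 * min (Suc b) A)) = (\<Sum>b<A. q ^ (2 * Suc b))" by (intro sum.cong) auto
    also have "\<dots> = c * (1 - q ^ (2 * A))" unfolding q_def by (rule geometric_sum_c)
    also have "(\<Sum>b=A..<h. q ^ (2 * min (Suc b) A)) = (\<Sum>b=A..<h. q ^ (2 * A))" by (intro sum.cong) auto
    also have "\<dots> = (real h - real A) * q ^ (2 * A)" using False by (simp add: of_nat_diff)
    finally have eq: "(\<Sum>b<h. q ^ (2 * min (Suc b) A)) = c + q ^ (2 * A) * (real h - real A - c)"
      by (simp add: algebra_simps)
    have hA: "real h - real A \<le> j" using Aj hk(3) by simp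
    show ?thesis
    proof (cases "real h - real A \<le> c")
      case True
      then have "q ^ (2 * A) * (real h - real A - c) \<le> 0" using q by (intro mult_nonneg_nonpos) auto
      then show ?thesis using eq by simp
    next
      case False
      have "q ^ (2 * A) * (real h - real A - c) \<le> q ^ (2 * A) * (j - c)"
        using hA q by (intro mult_left_mono) auto
      then show ?thesis using eq False hA by simp
    qed
  qed
  have Y1: "1 \<le> Y" "j + 1 \<le> Y" using hk by (auto simp: Y_def j_def of_nat_diff)
  \<comment> \<open>Here \<open>k + y = h + Y\<close> and \<open>h \<ge> r / 2 - 1 / 2\<close>, with
    equality for odd \<open>r\<close>; this is the origin of the \<open>- 1 / 2\<close> in the trunk
    bounds.\<close>
  have "exp (a * (real r / 2 - 1 / 2 + Y)) \<le> exp (a * real (k + y))"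
    using hk a_pos by (simp add: Y_def of_nat_diff)
  also have "\<dots> = exp a ^ (k + y)" by (simp flip: exp_of_nat_mult add: mult.commute)
  finally have top: "exp (a * (real r / 2 - 1 / 2 + Y)) \<le> exp a ^ (k + y)" .
  have "1 + Y + (\<Sum>b<h. q ^ (2 * min (Suc b) A)) \<le> exp (a * (real r / 2 - 1 / 2 + Y))"
    using S
  proof
    assume "(\<Sum>b<h. q ^ (2 * min (Suc b) A)) \<le> c"
    then show ?thesis using short_trunk_bound[OF Y1(1)] by linarith
  next
    assume "c \<le> j \<and> (\<Sum>b<h. q ^ (2 * min (Suc b) A)) \<le> c + q ^ (2 * A) * (j - c)"
    moreover have "real r / 2 - j \<le> real A" using Aj hk(3) by simp
    ultimately show ?thesis using long_trunk_bound[of j A Y] Y1(2) qA by simp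
  qed
  then have "1 + Y + (\<Sum>b<h. q ^ (2 * min (Suc b) A)) \<le> exp a ^ (k + y)" using top by linarith
  then show ?thesis using split unfolding q(3) by (simp add: Y_def h_def A_def)
qed

end

section \<open>The parameter \<open>s\<close> and the bound for trees\<close>

text \<open>The function \<open>F\<close> vanishes at 0 and has derivative
  \<open>ln (x + 1)\<close>, so it increases strictly and takes the value \<open>u\<close>
  once.\<close>

lemma optimal_s_unique:
  assumes "1 \<le> u"
  shows "\<exists>!s::real. 0 < s \<and> u + s = (s + 1) * ln (s + 1)"
proof -
  define F where "F x = (x + 1) * ln (x + 1) - x" for x :: real
  have deriv: "(F has_real_derivative ln (x + 1)) (at x)" if "0 \<le> x" for x
    unfolding F_def using that by (auto intro!: derivative_eq_intros simp: field_simps)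
  have mono: "F x < F y" if "0 \<le> x" "x < y" for x y
  proof (rule DERIV_pos_imp_increasing_open[OF that(2)])
    fix z assume "x < z" "z < y"
    then have "0 < ln (z + 1)" "0 \<le> z" using that by auto
    then show "\<exists>d. DERIV F z :> d \<and> 0 < d" using deriv by blast
  next
    show "continuous_on {x..y} F"
      by (intro continuous_at_imp_continuous_on ballI DERIV_isCont[OF deriv]) (use that in auto)
  qed
  \<comment> \<open>With this \<open>M\<close> the logarithm at \<open>M - 1\<close> is
    \<open>u + 1\<close>, so \<open>F (M - 1)\<close> exceeds \<open>u\<close>.\<close>
  define M where "M = exp (u + 1)"
  have M: "1 < M" using assms by (simp add: M_def)
  have "F (M - 1) = M * u + 1" by (simp add: F_def M_def algebra_simps)
  also have "\<dots> \<ge> u" using M assms mult_right_mono[of 1 M u] by linarith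
  finally have "\<exists>x. 0 \<le> x \<and> x \<le> M - 1 \<and> F x = u"
    using M assms by (intro IVT) (auto simp: F_def intro!: DERIV_isCont[OF deriv, unfolded F_def])
  then obtain s where s: "0 \<le> s" "F s = u" by blast
  have "s \<noteq> 0" using s assms by (auto simp: F_def)
  then have "0 < s \<and> u + s = (s + 1) * ln (s + 1)" using s by (auto simp: F_def)
  moreover have "s' = s" if "0 < s' \<and> u + s' = (s' + 1) * ln (s' + 1)" for s'
  proof -
    have "F s' = u" using that by (simp add: F_def)
    then show ?thesis using mono[of s s'] mono[of s' s] s that by (cases s s' rule: linorder_cases) auto
  qed
  ultimately show ?thesis by blast
qed

theorem theorem4p3:
  fixes r :: nat
  assumes "r \<ge> 2"
  shows "(\<exists>!s::real. 0 < s \<and> real r / 2 + s = (s + 1) * ln (s + 1)) \<and>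
    (\<forall>s \<alpha> :: real.
       0 < s \<and> real r / 2 + s = (s + 1) * ln (s + 1) \<and>
       \<alpha> = (s + 1) powr (1 / (real r / 2 + s)) \<longrightarrow>
       \<alpha> = exp (1 / (s + 1)) \<and>
       (\<forall>(V :: 'a set) (E :: 'a set set) n. is_tree V E \<and> card V = n \<longrightarrow>
          real (num_r_matchings r V E) \<le> (s + 1) * (exp (1 / real r) * \<alpha>) ^ (n - 1)))"
proof (intro conjI allI impI)
  show "\<exists>!s::real. 0 < s \<and> real r / 2 + s = (s + 1) * ln (s + 1)"
    using assms by (intro optimal_s_unique) simp
next
  fix s \<alpha> :: real
  assume "0 < s \<and> real r / 2 + s = (s + 1) * ln (s + 1) \<and> \<alpha> = (s + 1) powr (1 / (real r / 2 + s))"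
  then have s: "0 < s" and s_eq: "real r / 2 + s = (s + 1) * ln (s + 1)"
    and \<alpha>: "\<alpha> = (s + 1) powr (1 / (real r / 2 + s))" by auto
  show \<alpha>_exp: "\<alpha> = exp (1 / (s + 1))"
    unfolding \<alpha> s_eq powr_def using s by simp
  fix V :: "'a set" and E :: "'a set set" and n
  assume "is_tree V E \<and> card V = n"
  then have tree: "is_tree V E" and n: "card V = n" by auto
  define a where "a = 1 / (s + 1) + 1 / real r"
  interpret growth_rate r "s + 1" a
    by unfold_locales (use assms s s_eq a_def in \<open>auto simp: algebra_simps\<close>)
  obtain R end1 end2 where cut: "cut_tree V E R end1 end2"
    and le: "num_r_matchings r V E \<le> card {M. cut_tree.matching R end1 r E M}"
    using num_r_matchings_le[OF tree] .
  have "1 + real m \<le> (s + 1) * exp a ^ m" for m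
  proof -
    have "1 + real m \<le> (s + 1) * (1 + real m * (1 / (s + 1)))" using s by (simp add: field_simps)
    also have "\<dots> \<le> (s + 1) * (1 + real m * a)"
      using s assms by (intro mult_left_mono add_left_mono) (auto simp: a_def)
    also have "\<dots> \<le> (s + 1) * exp (real m * a)"
      using s by (intro mult_left_mono exp_ge_add_one_self) auto
    finally show ?thesis by (simp add: exp_of_nat_mult)
  qed
  then have "real (card {M. cut_tree.matching R end1 r E M}) \<le> (s + 1) * exp a ^ card E"
    using s a_pos cell_inequality by (intro cut_tree.card_matchings_le[OF cut]) auto
  moreover have "card E = n - 1" using card_tree_edges[OF tree] n by simp
  moreover have "exp a = exp (1 / real r) * \<alpha>" unfolding \<alpha>_exp a_def by (simp flip: exp_add)
  ultimately show "real (num_r_matchings r V E) \<le> (s + 1) * (exp (1 / real r) * \<alpha>) ^ (n - 1)"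
    using le by simp
qed

end
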